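(* There exist an absolute constant $c_0>0$ and a function $m:[1,\infty)\to\mathbb{N}$ such that the following holds. Let $G$ be a residually nilpotent group, let $K\ge1$, and let $A$ be a $K$-approximate subgroup of $G$. Then there exist subgroups $H\lhd C\subseteq G$ such that (1) $H\subseteq A^{m(K)}$; (2) $C/H$ is nilpotent of step at most $K^6$; (3) $A$ can be covered by at most $\exp(K^{c_0})$ left cosets of $C$.
   Context: For a subset $A$ of a group and an integer $m\ge1$, $A^m$ denotes the set of all products $a_1\cdots a_m$ with $a_i\in A$. A finite set $A\subseteq G$ is a $K$-approximate subgroup of $G$ if $A$ is symmetric ($A=A^{-1}$), contains the identity, and there exists a set $X\subseteq G$ with $|X|\le K$ such that $A^2\subseteq XA$. A group $G$ is residually nilpotent if for every non-identity $g\in G$ there is a homomorphism $\pi$ from $G$ to a nilpotent group with $\pi(g)\neq1$. *)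

theory Defs
  imports Complex_Main "HOL-Algebra.Generated_Groups" "HOL-Algebra.Left_Coset"
begin

primrec set_power :: "('a, 'b) monoid_scheme \<Rightarrow> 'a set \<Rightarrow> nat \<Rightarrow> 'a set" where
  "set_power G A 0 = {\<one>\<^bsub>G\<^esub>}"
| "set_power G A (Suc n) = A <#>\<^bsub>G\<^esub> set_power G A n"

definition approximate_subgroup :: "('a, 'b) monoid_scheme \<Rightarrow> real \<Rightarrow> 'a set \<Rightarrow> bool" where
  "approximate_subgroup G K A \<longleftrightarrow>
     finite A \<and> A \<subseteq> carrier G \<and> set_inv\<^bsub>G\<^esub> A = A \<and> \<one>\<^bsub>G\<^esub> \<in> A \<and>
     (\<exists>X. X \<subseteq> carrier G \<and> finite X \<and> real (card X) \<le> K \<and> set_power G A 2 \<subseteq> X <#>\<^bsub>G\<^esub> A)"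

text \<open>Indexing: \<open>lower_central G n\<close> is the term usually written $\gamma_{n+1}(G)$, so that
  a group of step at most \<open>s\<close> is one for which \<open>lower_central G s\<close> is trivial
  (step 0: trivial group, step at most 1: abelian).\<close>

primrec lower_central :: "('a, 'b) monoid_scheme \<Rightarrow> nat \<Rightarrow> 'a set" where
  "lower_central G 0 = carrier G"
| "lower_central G (Suc n) = generate G
     {x \<otimes>\<^bsub>G\<^esub> y \<otimes>\<^bsub>G\<^esub> inv\<^bsub>G\<^esub> x \<otimes>\<^bsub>G\<^esub> inv\<^bsub>G\<^esub> y | x y. x \<in> lower_central G n \<and> y \<in> carrier G}"

definition nilpotent_of_step_at_most :: "('a, 'b) monoid_scheme \<Rightarrow> nat \<Rightarrow> bool" where
  "nilpotent_of_step_at_most G s \<longleftrightarrow> group G \<and> lower_central G s = {\<one>\<^bsub>G\<^esub>}"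

definition nilpotent_group :: "('a, 'b) monoid_scheme \<Rightarrow> bool" where
  "nilpotent_group G \<longleftrightarrow> (\<exists>s. nilpotent_of_step_at_most G s)"

text \<open>The target group has to live on a fixed type. The type \<open>'a set\<close> accommodates all quotients
  of \<open>G\<close>, so nothing is lost: a homomorphism to a nilpotent group on any other type will do as
  well (\<open>residually_nilpotentI\<close> below).\<close>

definition residually_nilpotent :: "('a, 'b) monoid_scheme \<Rightarrow> bool" where
  "residually_nilpotent G \<longleftrightarrow>
     (\<forall>g \<in> carrier G. g \<noteq> \<one>\<^bsub>G\<^esub> \<longrightarrow>
        (\<exists>(N :: 'a set monoid) \<pi>. nilpotent_group N \<and> \<pi> \<in> hom G N \<and> \<pi> g \<noteq> \<one>\<^bsub>N\<^esub>))"

lemma (in group) lower_central_carrier: "lower_central G n \<subseteq> carrier G"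
proof (induction n)
  case (Suc n)
  then show ?case
    unfolding lower_central.simps by (intro generate_incl) (auto simp: subset_iff)
qed auto

lemma (in group) one_in_lower_central: "\<one> \<in> lower_central G n"
  by (cases n) (auto intro: generate.one)

lemma (in group_hom) lower_central_image: "h ` lower_central G n \<subseteq> lower_central H n"
proof (induction n)
  case 0
  then show ?case by auto
next
  case (Suc n)
  let ?S = "{x \<otimes> y \<otimes> inv x \<otimes> inv y | x y. x \<in> lower_central G n \<and> y \<in> carrier G}"
  have S: "?S \<subseteq> carrier G"
    using G.lower_central_carrier[of n] by (auto simp: subset_iff)
  have "h ` ?S \<subseteq> {x \<otimes>\<^bsub>H\<^esub> y \<otimes>\<^bsub>H\<^esub> inv\<^bsub>H\<^esub> x \<otimes>\<^bsub>H\<^esub> inv\<^bsub>H\<^esub> y | x y.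
                    x \<in> lower_central H n \<and> y \<in> carrier H}"
  proof clarify
    fix x y assume xy: "x \<in> lower_central G n" "y \<in> carrier G"
    then have "x \<in> carrier G" "h x \<in> lower_central H n"
      using G.lower_central_carrier[of n] Suc by auto
    then show "\<exists>x' y'. h (x \<otimes> y \<otimes> inv x \<otimes> inv y) =
        x' \<otimes>\<^bsub>H\<^esub> y' \<otimes>\<^bsub>H\<^esub> inv\<^bsub>H\<^esub> x' \<otimes>\<^bsub>H\<^esub> inv\<^bsub>H\<^esub> y' \<and> x' \<in> lower_central H n \<and> y' \<in> carrier H"
      using xy by (intro exI[of _ "h x"] exI[of _ "h y"]) auto
  qed
  then have "generate H (h ` ?S) \<subseteq> lower_central H (Suc n)"
    unfolding lower_central.simps by (rule H.mono_generate)
  then show ?case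
    unfolding lower_central.simps using generate_img[OF S] by simp
qed

lemma residually_nilpotentI:
  fixes G :: "('a, 'b) monoid_scheme"
  assumes "group G"
    and "\<And>g. g \<in> carrier G \<Longrightarrow> g \<noteq> \<one>\<^bsub>G\<^esub> \<Longrightarrow>
      \<exists>(N :: ('c, 'd) monoid_scheme) \<pi>. nilpotent_group N \<and> \<pi> \<in> hom G N \<and> \<pi> g \<noteq> \<one>\<^bsub>N\<^esub>"
  shows "residually_nilpotent G"
  unfolding residually_nilpotent_def
proof (intro ballI impI)
  fix g assume g: "g \<in> carrier G" "g \<noteq> \<one>\<^bsub>G\<^esub>"
  then obtain N :: "('c, 'd) monoid_scheme" and \<pi> where
    N: "nilpotent_group N" "\<pi> \<in> hom G N" "\<pi> g \<noteq> \<one>\<^bsub>N\<^esub>"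
    using assms(2) by blast
  then obtain s where s: "group N" "lower_central N s = {\<one>\<^bsub>N\<^esub>}"
    by (auto simp: nilpotent_group_def nilpotent_of_step_at_most_def)
  interpret p: group_hom G N \<pi>
    using assms(1) s N by (auto simp: group_hom_def group_hom_axioms_def)
  define k where "k = kernel G N \<pi>"
  define Q where "Q = G Mod k"
  define \<phi> where "\<phi> = (\<lambda>X. the_elem (\<pi> ` X))"
  have nk: "k \<lhd> G" unfolding k_def by (rule p.normal_kernel)
  have Q: "group Q" unfolding Q_def using nk by (rule normal.factorgroup_is_group)
  have hom: "\<phi> \<in> hom Q N" unfolding \<phi>_def Q_def k_def by (rule p.FactGroup_hom)
  interpret q: group_hom Q N \<phi>
    using Q s hom by (auto simp: group_hom_def group_hom_axioms_def)
  have inj: "inj_on \<phi> (carrier Q)"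
    unfolding \<phi>_def Q_def k_def by (rule p.FactGroup_inj_on)
  have "X = \<one>\<^bsub>Q\<^esub>" if X: "X \<in> lower_central Q s" for X
  proof -
    have "X \<in> carrier Q"
      using X group.lower_central_carrier[OF Q, of s] by (rule subsetD[rotated])
    moreover have "\<phi> X = \<phi> \<one>\<^bsub>Q\<^esub>"
      using q.lower_central_image[of s] X s(2) by (simp add: image_subset_iff)
    ultimately show ?thesis
      using inj_onD[OF inj, of X "\<one>\<^bsub>Q\<^esub>"] q.G.one_closed by blast
  qed
  then have "lower_central Q s = {\<one>\<^bsub>Q\<^esub>}"
    using group.one_in_lower_central[OF Q, of s] by blast
  then have "nilpotent_group Q"
    unfolding nilpotent_group_def nilpotent_of_step_at_most_def using Q by blast
  moreover have "(\<lambda>a. k #>\<^bsub>G\<^esub> a) \<in> hom G Q"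
    unfolding Q_def using nk by (rule normal.r_coset_hom_Mod)
  moreover have "k #>\<^bsub>G\<^esub> g \<noteq> \<one>\<^bsub>Q\<^esub>"
  proof
    assume "k #>\<^bsub>G\<^esub> g = \<one>\<^bsub>Q\<^esub>"
    then have "g \<in> k"
      using p.G.rcos_self[OF g(1) normal_imp_subgroup[OF nk]] by (simp add: Q_def)
    then show False using N by (simp add: k_def kernel_def)
  qed
  ultimately show "\<exists>(N :: 'a set monoid) \<pi>. nilpotent_group N \<and> \<pi> \<in> hom G N \<and> \<pi> g \<noteq> \<one>\<^bsub>N\<^esub>"
    by blast
qed

definition covered_by_left_cosets ::
    "('a, 'b) monoid_scheme \<Rightarrow> 'a set \<Rightarrow> 'a set \<Rightarrow> real \<Rightarrow> bool" where
  "covered_by_left_cosets G A C r \<longleftrightarrow>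
     (\<exists>F. F \<subseteq> lcosets\<^bsub>G\<^esub> C \<and> finite F \<and> real (card F) \<le> r \<and> A \<subseteq> \<Union>F)"

text \<open>\<open>uniform_bounds TYPE('a) c m\<close>: the constant \<open>c\<close> and the function \<open>m\<close> (of which only the
  values on $[1,\infty)$ matter) work simultaneously for all residually nilpotent groups whose
  elements are of type \<open>'a\<close>.

  HOL cannot quantify over types inside a formula, so in a statement of the form
  \<open>\<exists>c m. uniform_bounds TYPE('a) c m\<close> the witnesses could a priori depend on \<open>'a\<close>.
  Absoluteness of the constants is therefore expressed by additionally requiring
  \<open>\<forall>c m. uniform_bounds TYPE(nat) c m \<longrightarrow> uniform_bounds TYPE('a) c m\<close>: any constants for groups
  on the single type \<open>nat\<close> then serve for groups on every type. (This is true, as the finite set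
  \<open>A\<close> generates a countable subgroup.)\<close>

definition uniform_bounds :: "'a itself \<Rightarrow> real \<Rightarrow> (real \<Rightarrow> nat) \<Rightarrow> bool" where
  "uniform_bounds _ c m \<longleftrightarrow>
     (\<forall>(G :: 'a monoid) K A.
        group G \<longrightarrow> residually_nilpotent G \<longrightarrow> 1 \<le> K \<longrightarrow> approximate_subgroup G K A \<longrightarrow>
        (\<exists>H C. subgroup C G \<and> H \<lhd> G\<lparr>carrier := C\<rparr> \<and>
           H \<subseteq> set_power G A (m K) \<and>
           (\<exists>s::nat. real s \<le> K ^ 6 \<and> nilpotent_of_step_at_most (G\<lparr>carrier := C\<rparr> Mod H) s) \<and>
           covered_by_left_cosets G A C (exp (K powr c))))"

end

theory Submission
  imports Defs "HOL-Algebra.Weak_Morphisms" "HOL-Library.Countable_Set"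
begin

text \<open>
  Work modulo a term of the lower central series, and build a chain of subgroups $N$, each normal in
  a subgroup $C$ that shrinks along the way. Let $S$ be a term of the upper central series of $C$
  modulo $N$ such that $A^6 \cap S \subseteq A^2 N$ but the next term contains some $u \in A^6$
  outside $A^2 N$. Then $B = (A^2 \cap S) N$ is a subgroup, normalised by $A^2 \cap C$. The
  commutators $[a, u]$ with $a \in A^2 \cap C$ lie in $A^{16} \cap S$, hence in at most
  $K^{15}$ cosets of $B$. So on passing to the centraliser of $u$ modulo $B$ the number of left cosets
  needed to cover $A$ grows by a factor of at most $K^{15}$, and $N$ is replaced by
  $\langle B, u \rangle$. The translates of $A$ by the elements $u$ found in this way are disjoint
  subsets of $A^7$, so by Gleason's argument there are at most $K^6$ steps.

  At the end $C$ has a normal series of central cyclic factors, at most $K^6$ of them, alternating with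
  finite factors represented in $A^2$. A Schur-type argument moves the finite factors to the bottom:
  if $H_1 \subseteq A^m N_1$ and $N_1$ is central modulo $B$, then $[H_1, C]$ lies in a normal subgroup
  contained in $A^{m'} B$, where $m'$ depends only on $m$ and $K$. The subgroup is enlarged by groups of
  commutators $[F, c]$, each contained in boundedly many products, and the number of enlargements is
  bounded by Gleason's argument once more. In particular the step of the ambient nilpotent group never
  enters.

  A residually nilpotent group is reduced to this by pigeonhole over the terms of the lower central
  series, and an arbitrary type to the type of natural numbers because $A$ generates a countable group.
\<close>

section \<open>Commutators and relative central series\<close>

text \<open>Read \<open>rel x r\<close> as saying that x lies in the cell r. Choosing one member of
  \<open>X\<close> from every cell that meets \<open>X\<close> gives a cover centred in
  \<open>X\<close>, of no larger size.\<close>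

lemma finite_representatives:
  assumes "finite R" "\<And>x. x \<in> X \<Longrightarrow> \<exists>r\<in>R. rel x r"
  shows "\<exists>F. F \<subseteq> X \<and> finite F \<and> card F \<le> card R \<and> (\<forall>x\<in>X. \<exists>f\<in>F. \<exists>r\<in>R. rel x r \<and> rel f r)"
proof -
  define R' where "R' = {r\<in>R. \<exists>x\<in>X. rel x r}"
  have "\<forall>r\<in>R'. \<exists>x. x \<in> X \<and> rel x r"
    by (auto simp: R'_def)
  then obtain \<rho> where \<rho>: "\<And>r. r \<in> R' \<Longrightarrow> \<rho> r \<in> X \<and> rel (\<rho> r) r"
    by metis
  have fin: "finite R'"
    using assms(1) by (simp add: R'_def)
  have "card (\<rho> ` R') \<le> card R"
    using card_image_le[OF fin, of \<rho>] card_mono[OF assms(1), of R'] by (auto simp: R'_def)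
  moreover have "\<exists>f\<in>\<rho> ` R'. \<exists>r\<in>R. rel x r \<and> rel f r" if "x \<in> X" for x
  proof -
    obtain r where "r \<in> R" "rel x r"
      using assms(2)[OF \<open>x \<in> X\<close>] by blast
    then have "r \<in> R'"
      using \<open>x \<in> X\<close> by (auto simp: R'_def)
    then show ?thesis
      using \<rho> \<open>r \<in> R\<close> \<open>rel x r\<close> by blast
  qed
  ultimately show ?thesis
    using \<rho> fin by (intro exI[of _ "\<rho> ` R'"]) auto
qed

lemma set_multI: "a \<in> X \<Longrightarrow> b \<in> Y \<Longrightarrow> a \<otimes>\<^bsub>G\<^esub> b \<in> X <#>\<^bsub>G\<^esub> Y"
  by (auto simp: set_mult_def)

lemma set_multE:
  assumes "x \<in> X <#>\<^bsub>G\<^esub> Y"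
  obtains a b where "a \<in> X" "b \<in> Y" "x = a \<otimes>\<^bsub>G\<^esub> b"
  using assms by (auto simp: set_mult_def)

context group
begin

section \<open>Commutator identities and relative normality\<close>

definition commutator :: "'a \<Rightarrow> 'a \<Rightarrow> 'a" where
  "commutator x y = x \<otimes> y \<otimes> inv x \<otimes> inv y"

text \<open>Stated inside the ambient \<open>G\<close>, so that one set can be tested against
  several subgroups \<open>C\<close> without changing the group structure.\<close>

definition normal_in :: "'a set \<Rightarrow> 'a set \<Rightarrow> bool" where
  "normal_in N C \<longleftrightarrow> subgroup N G \<and> N \<subseteq> C \<and> (\<forall>c\<in>C. \<forall>x\<in>N. c \<otimes> x \<otimes> inv c \<in> N)"

lemma inv_mult_cancel: "x \<in> carrier G \<Longrightarrow> y \<in> carrier G \<Longrightarrow> inv x \<otimes> (x \<otimes> y) = y"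
  by (simp flip: m_assoc)

lemma mult_inv_cancel: "x \<in> carrier G \<Longrightarrow> y \<in> carrier G \<Longrightarrow> x \<otimes> (inv x \<otimes> y) = y"
  by (simp flip: m_assoc)

text \<open>As rewrite rules these bring group words to reduced, right-associated form, so that
  free-group identities become a matter of simplification.\<close>

lemmas group_word = m_assoc inv_mult_group inv_mult_cancel mult_inv_cancel

lemma commutator_closed: "x \<in> carrier G \<Longrightarrow> y \<in> carrier G \<Longrightarrow> commutator x y \<in> carrier G"
  by (simp add: commutator_def)

lemma inv_commutator:
  "x \<in> carrier G \<Longrightarrow> y \<in> carrier G \<Longrightarrow> inv (commutator x y) = commutator y x"
  by (simp add: commutator_def group_word)

lemma commutator_swap:
  assumes "subgroup Q G" "x \<in> carrier G" "y \<in> carrier G" "commutator x y \<in> Q"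
  shows "commutator y x \<in> Q"
  using subgroup.m_inv_closed[OF assms(1,4)] assms(2,3) by (simp add: inv_commutator)

lemma commutator_mult_left:
  "x \<in> carrier G \<Longrightarrow> y \<in> carrier G \<Longrightarrow> z \<in> carrier G \<Longrightarrow>
    commutator (x \<otimes> y) z = x \<otimes> commutator y z \<otimes> inv x \<otimes> commutator x z"
  by (simp add: commutator_def group_word)

lemma commutator_inv_left:
  "x \<in> carrier G \<Longrightarrow> z \<in> carrier G \<Longrightarrow>
    commutator (inv x) z = inv x \<otimes> inv (commutator x z) \<otimes> x"
  by (simp add: commutator_def group_word)

lemma commutator_conj:
  "d \<in> carrier G \<Longrightarrow> x \<in> carrier G \<Longrightarrow> y \<in> carrier G \<Longrightarrow>
    commutator (d \<otimes> x \<otimes> inv d) y = d \<otimes> commutator x (inv d \<otimes> y \<otimes> d) \<otimes> inv d"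
  by (simp add: commutator_def group_word)

lemma conj_eq_commutator_mult:
  "d \<in> carrier G \<Longrightarrow> x \<in> carrier G \<Longrightarrow> d \<otimes> x \<otimes> inv d = commutator d x \<otimes> x"
  by (simp add: commutator_def group_word)

lemma subgroup_commutator: "subgroup S G \<Longrightarrow> x \<in> S \<Longrightarrow> y \<in> S \<Longrightarrow> commutator x y \<in> S"
  unfolding commutator_def by (intro subgroup.m_closed subgroup.m_inv_closed)

lemma subgroup_conj: "subgroup S G \<Longrightarrow> x \<in> S \<Longrightarrow> y \<in> S \<Longrightarrow> x \<otimes> y \<otimes> inv x \<in> S"
  by (intro subgroup.m_closed subgroup.m_inv_closed)

lemma normal_in_subgroup: "normal_in N C \<Longrightarrow> subgroup N G"
  and normal_in_subset: "normal_in N C \<Longrightarrow> N \<subseteq> C"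
  and normal_in_conj: "normal_in N C \<Longrightarrow> c \<in> C \<Longrightarrow> x \<in> N \<Longrightarrow> c \<otimes> x \<otimes> inv c \<in> N"
  by (auto simp: normal_in_def)

lemma normal_in_refl: "subgroup C G \<Longrightarrow> normal_in C C"
  by (simp add: normal_in_def subgroup_conj)

lemma normal_in_Int: "normal_in M C \<Longrightarrow> normal_in N C \<Longrightarrow> normal_in (M \<inter> N) C"
  by (auto simp: normal_in_def subgroups_Inter_pair)

lemma normal_in_mono: "normal_in N C \<Longrightarrow> D \<subseteq> C \<Longrightarrow> N \<subseteq> D \<Longrightarrow> normal_in N D"
  by (auto simp: normal_in_def)

lemma normal_in_conj_inv:
  assumes "normal_in N C" "subgroup C G" "c \<in> C" "x \<in> N"
  shows "inv c \<otimes> x \<otimes> c \<in> N"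
  using normal_in_conj[OF assms(1) subgroup.m_inv_closed[OF assms(2,3)] assms(4)]
    subgroup.mem_carrier[OF assms(2,3)] by simp

lemma normal_in_commutator:
  assumes "normal_in N C" "subgroup C G" "x \<in> N" "c \<in> C"
  shows "commutator x c \<in> N" "commutator c x \<in> N"
proof -
  have N: "subgroup N G" "x \<in> carrier G" "c \<in> carrier G"
    using normal_in_subgroup[OF assms(1)] subgroup.mem_carrier[OF normal_in_subgroup[OF assms(1)] assms(3)]
      subgroup.mem_carrier[OF assms(2,4)] by auto
  show 1: "commutator c x \<in> N"
    unfolding commutator_def
    by (rule subgroup.m_closed[OF N(1) normal_in_conj[OF assms(1,4,3)]
          subgroup.m_inv_closed[OF N(1) assms(3)]])
  show "commutator x c \<in> N"
    using subgroup.m_inv_closed[OF N(1) 1] N by (simp add: inv_commutator)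
qed

text \<open>The elements that conjugation by \<open>g\<close> sends into \<open>H\<close> form a
  subgroup, and it contains \<open>S\<close>.\<close>

lemma conj_generate:
  assumes "subgroup H G" "S \<subseteq> carrier G" "g \<in> carrier G"
    and "\<And>x. x \<in> S \<Longrightarrow> g \<otimes> x \<otimes> inv g \<in> H" "x \<in> generate G S"
  shows "g \<otimes> x \<otimes> inv g \<in> H"
proof -
  have "subgroup {x \<in> carrier G. g \<otimes> x \<otimes> inv g \<in> H} G"
  proof (rule subgroupI)
    have "\<one> \<in> {x \<in> carrier G. g \<otimes> x \<otimes> inv g \<in> H}"
      using assms(3) subgroup.one_closed[OF assms(1)] by simp
    then show "{x \<in> carrier G. g \<otimes> x \<otimes> inv g \<in> H} \<noteq> {}"
      by (metis empty_iff)
  next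
    fix a assume "a \<in> {x \<in> carrier G. g \<otimes> x \<otimes> inv g \<in> H}"
    then have a: "a \<in> carrier G" "g \<otimes> a \<otimes> inv g \<in> H" by auto
    then have "inv (g \<otimes> a \<otimes> inv g) \<in> H"
      using subgroup.m_inv_closed[OF assms(1)] by blast
    then show "inv a \<in> {x \<in> carrier G. g \<otimes> x \<otimes> inv g \<in> H}"
      using a assms(3) by (simp add: group_word)
  next
    fix a b assume "a \<in> {x \<in> carrier G. g \<otimes> x \<otimes> inv g \<in> H}" "b \<in> {x \<in> carrier G. g \<otimes> x \<otimes> inv g \<in> H}"
    then have ab: "a \<in> carrier G" "b \<in> carrier G" "g \<otimes> a \<otimes> inv g \<in> H" "g \<otimes> b \<otimes> inv g \<in> H"
      by auto
    then have "(g \<otimes> a \<otimes> inv g) \<otimes> (g \<otimes> b \<otimes> inv g) \<in> H"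
      using subgroup.m_closed[OF assms(1)] by blast
    then show "a \<otimes> b \<in> {x \<in> carrier G. g \<otimes> x \<otimes> inv g \<in> H}"
      using ab assms(3) by (simp add: group_word)
  qed auto
  moreover have "S \<subseteq> {x \<in> carrier G. g \<otimes> x \<otimes> inv g \<in> H}"
    using assms by auto
  ultimately show ?thesis
    using generate_subgroup_incl assms(5) by blast
qed

text \<open>Conjugation by a product is a composite of conjugations, and inverses of generators are
  again generators, so testing generators suffices.\<close>

lemma normal_in_generate:
  assumes H: "subgroup H G" "H \<subseteq> generate G S" and S: "S \<subseteq> carrier G"
    and S_inv: "\<And>c. c \<in> S \<Longrightarrow> inv c \<in> S"
    and conj: "\<And>c x. c \<in> S \<Longrightarrow> x \<in> H \<Longrightarrow> c \<otimes> x \<otimes> inv c \<in> H"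
  shows "normal_in H (generate G S)"
  unfolding normal_in_def
proof (intro conjI H ballI)
  fix c x assume "c \<in> generate G S" "x \<in> H"
  then show "c \<otimes> x \<otimes> inv c \<in> H"
  proof (induction arbitrary: x)
    case one
    then show ?case using subgroup.mem_carrier[OF H(1)] by simp
  next
    case (incl h)
    then show ?case using conj by blast
  next
    case (inv h)
    then show ?case using conj[OF S_inv] by blast
  next
    case (eng h1 h2)
    then have "h1 \<in> carrier G" "h2 \<in> carrier G" "x \<in> carrier G"
      using generate_in_carrier[OF S] subgroup.mem_carrier[OF H(1)] by blast+
    then show ?case
      using eng.IH(1)[OF eng.IH(2)[OF eng.prems]] by (simp add: group_word)
  qed
qed

text \<open>This is the preimage in \<open>C\<close> of the centraliser of the image of u in C/Q;
  normality of \<open>Q\<close> absorbs the conjugations in the commutator identities.\<close>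

lemma centralizer_subgroup:
  assumes C: "subgroup C G" and Q: "normal_in Q C" and u: "u \<in> C"
  shows "subgroup {c \<in> C. commutator c u \<in> Q} G"
proof (rule subgroupI)
  note Qs = normal_in_subgroup[OF Q]
  show "{c \<in> C. commutator c u \<in> Q} \<subseteq> carrier G"
    using subgroup.subset[OF C] by auto
  have "commutator \<one> u = \<one>"
    using subgroup.mem_carrier[OF C u] by (simp add: commutator_def)
  then show "{c \<in> C. commutator c u \<in> Q} \<noteq> {}"
    using subgroup.one_closed[OF C] subgroup.one_closed[OF Qs] by force
next
  note Qs = normal_in_subgroup[OF Q]
  note car = subgroup.mem_carrier[OF C]
  {
    fix a assume a: "a \<in> {c \<in> C. commutator c u \<in> Q}"
    then have "inv a \<otimes> inv (commutator a u) \<otimes> a \<in> Q"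
      using normal_in_conj_inv[OF Q C] subgroup.m_inv_closed[OF Qs] by blast
    then show "inv a \<in> {c \<in> C. commutator c u \<in> Q}"
      using a u car subgroup.m_inv_closed[OF C] by (simp add: commutator_inv_left)
  }
  fix a b assume ab: "a \<in> {c \<in> C. commutator c u \<in> Q}" "b \<in> {c \<in> C. commutator c u \<in> Q}"
  then have "a \<otimes> commutator b u \<otimes> inv a \<otimes> commutator a u \<in> Q"
    using normal_in_conj[OF Q] subgroup.m_closed[OF Qs] by blast
  then show "a \<otimes> b \<in> {c \<in> C. commutator c u \<in> Q}"
    using ab u car subgroup.m_closed[OF C] by (simp add: commutator_mult_left)
qed

section \<open>Relative centers and central series\<close>

definition center_mod :: "'a set \<Rightarrow> 'a set \<Rightarrow> 'a set" where
  "center_mod C Q = {c \<in> C. \<forall>d\<in>C. commutator c d \<in> Q}"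

text \<open>\<open>center_mod C Q\<close> is the preimage of the center of C/Q, an intersection of
  relative centralisers. For invariance, \<open>commutator_conj\<close> shifts the conjugation to
  the second argument, which still ranges over \<open>C\<close>.\<close>

lemma center_mod_normal_in:
  assumes C: "subgroup C G" and Q: "normal_in Q C"
  shows "normal_in (center_mod C Q) C"
proof -
  have "center_mod C Q = (\<Inter>d\<in>C. {c \<in> C. commutator c d \<in> Q})"
    using subgroup.one_closed[OF C] by (auto simp: center_mod_def)
  moreover have "subgroup (\<Inter>d\<in>C. {c \<in> C. commutator c d \<in> Q}) G"
    using centralizer_subgroup[OF C Q] subgroup.one_closed[OF C] by (intro subgroups_Inter) auto
  moreover have "c \<otimes> x \<otimes> inv c \<in> center_mod C Q" if c: "c \<in> C" and x: "x \<in> center_mod C Q" for c x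
  proof -
    have xC: "x \<in> C" using x by (simp add: center_mod_def)
    have "commutator (c \<otimes> x \<otimes> inv c) d \<in> Q" if d: "d \<in> C" for d
    proof -
      have "inv c \<otimes> d \<otimes> c \<in> C"
        by (intro subgroup.m_closed[OF C] subgroup.m_inv_closed[OF C] c d)
      then have "c \<otimes> commutator x (inv c \<otimes> d \<otimes> c) \<otimes> inv c \<in> Q"
        using x c normal_in_conj[OF Q] by (simp add: center_mod_def)
      then show ?thesis
        using c d xC subgroup.mem_carrier[OF C] by (simp add: commutator_conj)
    qed
    then show ?thesis
      using c xC subgroup_conj[OF C] by (simp add: center_mod_def)
  qed
  ultimately show ?thesis
    by (auto simp: normal_in_def) (auto simp: center_mod_def)
qed

lemma subset_center_mod: "subgroup C G \<Longrightarrow> normal_in Q C \<Longrightarrow> Q \<subseteq> center_mod C Q"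
  using normal_in_commutator(1) normal_in_subset by (fastforce simp: center_mod_def)

text \<open>The preimages in \<open>C\<close> of the upper central series of C/N, starting with
  \<open>N\<close> itself.\<close>

primrec upper_central :: "'a set \<Rightarrow> 'a set \<Rightarrow> nat \<Rightarrow> 'a set" where
  "upper_central C N 0 = N"
| "upper_central C N (Suc k) = center_mod C (upper_central C N k)"

lemma upper_central_normal_in:
  "subgroup C G \<Longrightarrow> normal_in N C \<Longrightarrow> normal_in (upper_central C N k) C"
  by (induction k) (auto intro: center_mod_normal_in)

lemma subset_upper_central:
  assumes "subgroup C G" "normal_in N C"
  shows "N \<subseteq> upper_central C N k"
proof (induction k)
  case (Suc k)
  then show ?case
    using subset_center_mod[OF assms(1) upper_central_normal_in[OF assms], of k] by auto
qed simp

text \<open>A commutator with an element of \<open>C\<close> moves one term down the lower central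
  series, so the upper central series, read from the bottom, climbs at least as fast.\<close>

lemma lower_central_subset_upper_central:
  assumes "subgroup C G" "normal_in N C" "lower_central G n \<subseteq> N" "k \<le> n"
  shows "lower_central G (n - k) \<inter> C \<subseteq> upper_central C N k"
  using assms(4)
proof (induction k)
  case 0
  then show ?case using assms(3) by auto
next
  case (Suc k)
  have "commutator x d \<in> upper_central C N k"
    if x: "x \<in> lower_central G (n - Suc k)" "x \<in> C" and d: "d \<in> C" for x d
  proof -
    have "d \<in> carrier G" by (rule subgroup.mem_carrier[OF assms(1) d])
    then have "commutator x d \<in> lower_central G (Suc (n - Suc k))"
      unfolding lower_central.simps commutator_def using x(1) by (intro generate.incl) blast
    moreover have "Suc (n - Suc k) = n - k" using Suc.prems by simp
    moreover have "commutator x d \<in> C" using assms(1) x d by (simp add: subgroup_commutator)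
    ultimately show ?thesis using Suc by auto
  qed
  then show ?case by (auto simp: center_mod_def)
qed

lemma upper_central_eq:
  assumes "subgroup C G" "normal_in N C" "lower_central G n \<subseteq> N"
  shows "upper_central C N n = C"
  using lower_central_subset_upper_central[OF assms, of n] subgroup.subset[OF assms(1)]
    normal_in_subset[OF upper_central_normal_in[OF assms(1,2), of n]] by auto

text \<open>Expresses the series by the operations of \<open>G\<close>, which makes the lower
  central series of different subgroups comparable.\<close>

lemma lower_central_subgroup_Suc:
  assumes "subgroup C G"
  shows "lower_central (G\<lparr>carrier := C\<rparr>) (Suc n) =
    generate G {commutator x y | x y. x \<in> lower_central (G\<lparr>carrier := C\<rparr>) n \<and> y \<in> C}"
proof -
  interpret C: group "G\<lparr>carrier := C\<rparr>"
    using assms subgroup_imp_group by blast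
  have sub: "lower_central (G\<lparr>carrier := C\<rparr>) n \<subseteq> C"
    using C.lower_central_carrier[of n] by simp
  have eq: "{x \<otimes>\<^bsub>G\<lparr>carrier := C\<rparr>\<^esub> y \<otimes>\<^bsub>G\<lparr>carrier := C\<rparr>\<^esub> inv\<^bsub>G\<lparr>carrier := C\<rparr>\<^esub> x
      \<otimes>\<^bsub>G\<lparr>carrier := C\<rparr>\<^esub> inv\<^bsub>G\<lparr>carrier := C\<rparr>\<^esub> y | x y.
        x \<in> lower_central (G\<lparr>carrier := C\<rparr>) n \<and> y \<in> carrier (G\<lparr>carrier := C\<rparr>)} =
      {commutator x y | x y. x \<in> lower_central (G\<lparr>carrier := C\<rparr>) n \<and> y \<in> C}"
    using sub by (force simp: commutator_def m_inv_consistent[OF assms])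
  have "{commutator x y | x y. x \<in> lower_central (G\<lparr>carrier := C\<rparr>) n \<and> y \<in> C} \<subseteq> C"
    using sub subgroup_commutator[OF assms] by blast
  then show ?thesis
    unfolding lower_central.simps eq by (rule generate_consistent[OF _ assms])
qed

lemma lower_central_subset_Suc:
  assumes C: "subgroup C G" and H: "subgroup H G"
    and "lower_central (G\<lparr>carrier := C\<rparr>) n \<subseteq> H1"
    and "\<And>x c. x \<in> H1 \<Longrightarrow> c \<in> C \<Longrightarrow> commutator x c \<in> H"
  shows "lower_central (G\<lparr>carrier := C\<rparr>) (Suc n) \<subseteq> H"
  unfolding lower_central_subgroup_Suc[OF C]
  using assms(3,4) by (intro generate_subgroup_incl[OF _ H]) blast

lemma lower_central_mono:
  assumes C: "subgroup C G" and D: "subgroup D G" and "C \<subseteq> D"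
  shows "lower_central (G\<lparr>carrier := C\<rparr>) n \<subseteq> lower_central (G\<lparr>carrier := D\<rparr>) n"
proof (induction n)
  case (Suc n)
  then show ?case
    unfolding lower_central_subgroup_Suc[OF C] lower_central_subgroup_Suc[OF D]
    using assms(3) by (intro mono_generate) blast
qed (use assms in auto)

end

section \<open>Powers of an approximate subgroup\<close>

locale approximate_group = group +
  fixes A :: "'a set" and K :: real
  assumes K_ge_1: "1 \<le> K"
    and approximate_A: "approximate_subgroup G K A"
begin

abbreviation P :: "nat \<Rightarrow> 'a set" where
  "P \<equiv> set_power G A"

lemma finite_A: "finite A" and A_subset: "A \<subseteq> carrier G" and one_in_A: "\<one> \<in> A"
  using approximate_A by (auto simp: approximate_subgroup_def)

lemma inv_in_A:
  assumes "a \<in> A"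
  shows "inv a \<in> A"
proof -
  have "inv a \<in> set_inv A" using assms by (auto simp: SET_INV_def)
  then show ?thesis using approximate_A by (simp add: approximate_subgroup_def)
qed

lemma P_subset: "P n \<subseteq> carrier G"
  by (induction n) (use A_subset in \<open>auto simp: set_mult_def\<close>)

lemmas P_carrier = subsetD[OF P_subset]

lemma P_one: "P (Suc 0) = A"
proof -
  have "(\<Union>h\<in>A. {h \<otimes> \<one>}) = (\<Union>h\<in>A. {h})"
    using A_subset by (intro SUP_cong) auto
  then show ?thesis
    by (simp add: set_mult_def)
qed

lemma P_mult: "a \<in> P i \<Longrightarrow> b \<in> P j \<Longrightarrow> a \<otimes> b \<in> P (i + j)"
proof (induction i arbitrary: a)
  case 0
  then show ?case using P_carrier by simp
next
  case (Suc i)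
  then obtain x y where xy: "x \<in> A" "y \<in> P i" "a = x \<otimes> y"
    by (auto elim: set_multE)
  then have "x \<otimes> (y \<otimes> b) \<in> P (Suc i + j)"
    using Suc by (auto intro: set_multI)
  moreover have "x \<in> carrier G" "y \<in> carrier G" "b \<in> carrier G"
    using xy P_carrier A_subset Suc.prems by auto
  ultimately show ?case
    using xy by (simp add: m_assoc)
qed

lemma P_inv: "a \<in> P i \<Longrightarrow> inv a \<in> P i"
proof (induction i arbitrary: a)
  case (Suc i)
  then obtain x y where xy: "x \<in> A" "y \<in> P i" "a = x \<otimes> y"
    by (auto elim: set_multE)
  then have "inv y \<otimes> inv x \<in> P (i + Suc 0)"
    using Suc.IH[OF xy(2)] inv_in_A by (intro P_mult) (simp_all only: P_one)
  then show ?case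
    using xy A_subset P_carrier[OF xy(2)] by (auto simp: inv_mult_group)
qed simp

lemma one_in_P: "\<one> \<in> P n"
proof (induction n)
  case (Suc n)
  then show ?case using set_multI[OF one_in_A Suc, where G = G] by simp
qed simp

lemma P_mono: "i \<le> j \<Longrightarrow> P i \<subseteq> P j"
proof
  fix a assume "i \<le> j" "a \<in> P i"
  then show "a \<in> P j"
    using P_mult[OF \<open>a \<in> P i\<close> one_in_P[of "j - i"]] P_carrier[of a i] by simp
qed

lemma P_conj: "a \<in> P i \<Longrightarrow> x \<in> P j \<Longrightarrow> a \<otimes> x \<otimes> inv a \<in> P (i + j + i)"
  by (intro P_mult P_inv)

lemma P_commutator: "a \<in> P i \<Longrightarrow> x \<in> P j \<Longrightarrow> commutator a x \<in> P (i + j + i + j)"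
  unfolding commutator_def by (intro P_mult P_inv)

lemma finite_P: "finite (P n)"
  by (induction n) (auto simp: set_mult_def finite_A)

declare set_power.simps(2) [simp del]

text \<open>If A^(n+1) lies in YA and A^2 in XA, then A^(n+2) lies in YAA, hence in YXA. The
  exponent of \<open>K\<close> is one less than that of the set.\<close>

lemma P_cover:
  "\<exists>Y. Y \<subseteq> carrier G \<and> finite Y \<and> real (card Y) \<le> K ^ n \<and> (\<forall>x\<in>P (Suc n). \<exists>y\<in>Y. \<exists>a\<in>A. x = y \<otimes> a)"
proof (induction n)
  case 0
  show ?case
    unfolding P_one using A_subset by (intro exI[of _ "{\<one>}"]) (fastforce simp: subset_iff)
next
  case (Suc n)
  then obtain Y where Y: "Y \<subseteq> carrier G" "finite Y" "real (card Y) \<le> K ^ n"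
    "\<forall>x\<in>P (Suc n). \<exists>y\<in>Y. \<exists>a\<in>A. x = y \<otimes> a" by blast
  obtain X where X: "X \<subseteq> carrier G" "finite X" "real (card X) \<le> K" "P 2 \<subseteq> X <#> A"
    using approximate_A by (auto simp: approximate_subgroup_def)
  define Z where "Z = (\<lambda>(x, y). x \<otimes> y) ` (Y \<times> X)"
  have "card Z \<le> card Y * card X"
    using card_image_le[of "Y \<times> X"] X Y by (simp add: Z_def card_cartesian_product)
  then have "real (card Z) \<le> real (card Y) * real (card X)"
    by (metis of_nat_le_iff of_nat_mult)
  also have "\<dots> \<le> K ^ n * K"
    using X Y K_ge_1 by (intro mult_mono) auto
  finally have "real (card Z) \<le> K ^ Suc n" by (simp add: mult.commute)
  moreover have "\<exists>z\<in>Z. \<exists>a\<in>A. x = z \<otimes> a" if x: "x \<in> P (Suc (Suc n))" for x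
  proof -
    \<comment> \<open>\<open>set_power\<close> splits off a factor on the left, but the argument
      needs one on the right; symmetry of \<open>A\<close> allows passing to the inverse.\<close>
    from x have "inv x \<in> P (Suc (Suc n))" by (rule P_inv)
    then obtain a w where a: "a \<in> A" "w \<in> P (Suc n)" "inv x = a \<otimes> w"
      unfolding set_power.simps(2)[of G A "Suc n"] by (elim set_multE)
    have car: "a \<in> carrier G" "w \<in> carrier G" "x \<in> carrier G"
      using a A_subset P_carrier x by blast+
    have "x = inv (inv x)" using car by simp
    then have x_eq: "x = inv w \<otimes> inv a" using a(3) car by (simp add: inv_mult_group)
    obtain y b where y: "y \<in> Y" "b \<in> A" "inv w = y \<otimes> b"
      using Y(4) P_inv[OF a(2)] by blast
    have "b \<otimes> inv a \<in> P (Suc 0 + Suc 0)"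
      using y a inv_in_A by (intro P_mult) (simp_all only: P_one)
    then have "b \<otimes> inv a \<in> X <#> A" using X(4) by (auto simp: numeral_2_eq_2)
    then obtain c d where c: "c \<in> X" "d \<in> A" "b \<otimes> inv a = c \<otimes> d"
      by (elim set_multE)
    have car2: "y \<in> carrier G" "b \<in> carrier G" "c \<in> carrier G" "d \<in> carrier G"
      using y c X Y A_subset by auto
    have "x = (y \<otimes> c) \<otimes> d"
      using x_eq y(3) c(3) car car2 by (simp add: m_assoc)
    then show ?thesis
      using y c by (auto simp: Z_def)
  qed
  moreover have "Z \<subseteq> carrier G" "finite Z"
    using X Y by (auto simp: Z_def)
  ultimately show ?case
    by (intro exI[of _ Z]) blast
qed

lemma card_P_le: "real (card (P (Suc n))) \<le> K ^ n * real (card A)"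
proof -
  obtain Y where Y: "Y \<subseteq> carrier G" "finite Y" "real (card Y) \<le> K ^ n"
    "\<forall>x\<in>P (Suc n). \<exists>y\<in>Y. \<exists>a\<in>A. x = y \<otimes> a"
    using P_cover[of n] by (elim exE conjE) (rule that)
  have "P (Suc n) \<subseteq> (\<lambda>(x, y). x \<otimes> y) ` (Y \<times> A)"
    using Y(4) by force
  then have "card (P (Suc n)) \<le> card ((\<lambda>(x, y). x \<otimes> y) ` (Y \<times> A))"
    by (intro card_mono finite_imageI finite_cartesian_product Y finite_A)
  also have "\<dots> \<le> card Y * card A"
    using card_image_le[of "Y \<times> A"] Y finite_A by (simp add: card_cartesian_product)
  finally have "real (card (P (Suc n))) \<le> real (card Y) * real (card A)"
    by (metis of_nat_le_iff of_nat_mult)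
  also have "\<dots> \<le> K ^ n * real (card A)"
    using Y by (intro mult_right_mono) auto
  finally show ?thesis .
qed

section \<open>Separated sets and Gleason's counting argument\<close>

definition separated :: "'a set \<Rightarrow> bool" where
  "separated U \<longleftrightarrow> (\<forall>u\<in>U. \<forall>v\<in>U. u \<noteq> v \<longrightarrow> u \<otimes> inv v \<notin> P 2)"

text \<open>The translates of \<open>A\<close> by the elements of \<open>U\<close> are disjoint subsets of \<open>P (Suc k)\<close>.\<close>

lemma card_separated_le:
  assumes "separated U" "U \<subseteq> P k"
  shows "real (card U) \<le> K ^ k"
proof -
  have inj: "inj_on (\<lambda>(a, u). a \<otimes> u) (A \<times> U)"
  proof (rule inj_onI, clarify)
    fix a u b v assume au: "a \<in> A" "b \<in> A" "u \<in> U" "v \<in> U" and eq: "a \<otimes> u = b \<otimes> v"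
    have car: "a \<in> carrier G" "b \<in> carrier G" "u \<in> carrier G" "v \<in> carrier G"
      using au A_subset assms(2) P_carrier by blast+
    have "inv a \<otimes> b \<in> P (Suc 0 + Suc 0)"
      using au inv_in_A by (intro P_mult) (simp_all only: P_one)
    then have "inv a \<otimes> b \<in> P 2"
      by (simp only: add_Suc add_0 numeral_2_eq_2)
    moreover have "u \<otimes> inv v = inv a \<otimes> (a \<otimes> u) \<otimes> inv v"
      using car by (simp add: group_word)
    then have "u \<otimes> inv v = inv a \<otimes> b"
      unfolding eq using car by (simp add: m_assoc)
    ultimately have "u = v"
      using assms(1) au unfolding separated_def by metis
    then show "a = b \<and> u = v"
      using eq car by simp
  qed
  have "(\<lambda>(a, u). a \<otimes> u) ` (A \<times> U) \<subseteq> P (Suc k)"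
    using assms(2) by (auto simp: set_power.simps(2) intro: set_multI)
  then have "card (A \<times> U) \<le> card (P (Suc k))"
    using card_mono[OF finite_P] card_image[OF inj] by metis
  then have "card A * card U \<le> card (P (Suc k))"
    by (simp add: card_cartesian_product)
  then have "real (card A) * real (card U) \<le> K ^ k * real (card A)"
    using card_P_le[of k] by (metis (mono_tags) of_nat_le_iff of_nat_mult order_trans)
  moreover have "0 < card A"
    using one_in_A finite_A card_gt_0_iff by blast
  ultimately show ?thesis by simp
qed

text \<open>If u v^-1 were in \<open>P 2\<close> for some v in \<open>N\<close>, then u would lie in
  \<open>P 2 <#> N\<close>; symmetry of \<open>P 2\<close> settles v u^-1. Thus a strict growth step
  of a chain of subgroups enlarges the separated set.\<close>

lemma separated_insert:
  assumes "separated U" "subgroup N G" "U \<subseteq> N" "u \<in> carrier G" "u \<notin> P 2 <#> N"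
  shows "separated (insert u U)" "u \<notin> U"
proof -
  note car = subgroup.mem_carrier[OF assms(2)]
  have notin: "u \<otimes> inv v \<notin> P 2" if "v \<in> N" for v
  proof
    assume "u \<otimes> inv v \<in> P 2"
    then have "(u \<otimes> inv v) \<otimes> v \<in> P 2 <#> N" using that by (intro set_multI)
    then show False using assms that car by (simp add: m_assoc)
  qed
  show "u \<notin> U"
  proof
    assume "u \<in> U"
    then have "\<one> \<otimes> u \<in> P 2 <#> N" using assms(3) one_in_P by (intro set_multI) auto
    then show False using assms by simp
  qed
  have "v \<otimes> inv u \<notin> P 2" if "v \<in> N" for v
  proof
    assume "v \<otimes> inv u \<in> P 2"
    then have "inv (v \<otimes> inv u) \<in> P 2" by (rule P_inv)
    then show False using notin[OF that] assms that car by (simp add: inv_mult_group)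
  qed
  then show "separated (insert u U)"
    using assms(1,3) notin unfolding separated_def by blast
qed

text \<open>Elements a^-1 y^-1 and b^-1 y^-1 with the same y differ by a^-1 b in A^2. So the centres
  can be chosen in \<open>S\<close>, and then x r^-1 lies in \<open>S\<close> as well.\<close>

lemma subgroup_cover:
  assumes S: "subgroup S G"
  shows "\<exists>R. R \<subseteq> S \<and> finite R \<and> real (card R) \<le> K ^ n \<and>
    (\<forall>x\<in>P (Suc n) \<inter> S. \<exists>r\<in>R. x \<otimes> inv r \<in> P 2)"
proof -
  obtain Y where Y: "Y \<subseteq> carrier G" "finite Y" "real (card Y) \<le> K ^ n"
    "\<forall>x\<in>P (Suc n). \<exists>y\<in>Y. \<exists>a\<in>A. x = y \<otimes> a"
    using P_cover[of n] by (elim exE conjE) (rule that)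
  have "\<exists>y\<in>Y. inv x \<in> y <# A" if "x \<in> P (Suc n) \<inter> S" for x
    using Y(4) P_inv[of x "Suc n"] that by (fastforce simp: l_coset_def)
  then obtain F where F: "F \<subseteq> P (Suc n) \<inter> S" "finite F" "card F \<le> card Y"
    "\<forall>x\<in>P (Suc n) \<inter> S. \<exists>f\<in>F. \<exists>y\<in>Y. inv x \<in> y <# A \<and> inv f \<in> y <# A"
    using finite_representatives[OF Y(2), of "P (Suc n) \<inter> S" "\<lambda>x y. inv x \<in> y <# A"] by blast
  have "\<exists>f\<in>F. x \<otimes> inv f \<in> P 2" if x: "x \<in> P (Suc n) \<inter> S" for x
  proof -
    obtain f y a b where f: "f \<in> F" "y \<in> Y" "a \<in> A" "b \<in> A" "inv x = y \<otimes> a" "inv f = y \<otimes> b"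
      using F(4) x unfolding l_coset_def by blast
    have car: "y \<in> carrier G" "a \<in> carrier G" "b \<in> carrier G" "x \<in> carrier G"
      using f Y A_subset P_carrier[of x "Suc n"] x by auto
    have "x = inv (inv x)" using car by simp
    then have "x \<otimes> inv f = inv a \<otimes> b"
      unfolding f(6) unfolding f(5) using car by (simp add: group_word)
    moreover have "inv a \<otimes> b \<in> P (Suc 0 + Suc 0)"
      using f inv_in_A by (intro P_mult) (simp_all only: P_one)
    ultimately have "x \<otimes> inv f \<in> P 2"
      by (simp only: add_Suc add_0 numeral_2_eq_2)
    then show ?thesis
      using f(1) by blast
  qed
  then show ?thesis
    using F Y(3) by (intro exI[of _ F]) auto
qed

lemma set_power_mult_assoc:
  assumes "X \<subseteq> P i <#> Y" "Y \<subseteq> P j <#> Z" "Z \<subseteq> carrier G"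
  shows "X \<subseteq> P (i + j) <#> Z"
proof
  fix x assume "x \<in> X"
  then obtain a y where a: "a \<in> P i" "y \<in> Y" "x = a \<otimes> y"
    using assms(1) by (blast elim: set_multE)
  obtain b z where b: "b \<in> P j" "z \<in> Z" "y = b \<otimes> z"
    using assms(2) a(2) by (blast elim: set_multE)
  have "(a \<otimes> b) \<otimes> z \<in> P (i + j) <#> Z"
    using a b by (intro set_multI P_mult)
  then show "x \<in> P (i + j) <#> Z"
    using a b P_carrier assms(3) by (auto simp: m_assoc subset_iff)
qed

lemma P_mult_set_mono: "i \<le> j \<Longrightarrow> P i <#> Z \<subseteq> P j <#> Z"
  by (intro mono_set_mult P_mono order_refl)

lemma subset_P_mult_set: "Z \<subseteq> carrier G \<Longrightarrow> Z \<subseteq> P n <#> Z"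
  using set_multI[OF one_in_P, of _ Z G n] by (auto simp: subset_iff)

text \<open>Inverses and products of elements of \<open>P 2 \<inter> S\<close>, and their conjugates
  by \<open>P 2 \<inter> C\<close>, stay in \<open>P 6 \<inter> S\<close>, which
  \<open>small\<close> sends back into \<open>P 2 <#> N\<close>. Normality in \<open>C\<close> is
  then checked on generators.\<close>

lemma normal_in_power_mult:
  assumes C: "subgroup C G" "C = generate G ((P 2 \<inter> C) \<union> N)"
    and N: "normal_in N C" and S: "normal_in S C" "N \<subseteq> S"
    and small: "P 6 \<inter> S \<subseteq> P 2 <#> N"
  shows "normal_in ((P 2 \<inter> S) <#> N) C"
proof -
  let ?B = "(P 2 \<inter> S) <#> N"
  note Ns = normal_in_subgroup[OF N] and Ss = normal_in_subgroup[OF S(1)]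
  have carC: "C \<subseteq> carrier G" and carN: "N \<subseteq> carrier G" and carS: "S \<subseteq> carrier G"
    using C(1) Ns Ss subgroup.subset by blast+
  have NC: "N \<subseteq> C" and SC: "S \<subseteq> C"
    using N S by (auto simp: normal_in_def)
  \<comment> \<open>As \<open>N\<close> lies in \<open>S\<close>, the factor in \<open>P 2\<close>
    supplied by \<open>small\<close> lies in \<open>S\<close> too.\<close>
  have P6: "x \<in> ?B" if x: "x \<in> P 6" "x \<in> S" for x
  proof -
    obtain a n where a: "a \<in> P 2" "n \<in> N" "x = a \<otimes> n"
      using small x by (blast elim: set_multE)
    then have "a = x \<otimes> inv n"
      using P_carrier carN by (auto simp: m_assoc)
    then have "a \<in> S"
      using x(2) a(2) S(2) subgroup.m_closed[OF Ss] subgroup.m_inv_closed[OF Ss] by blast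
    then show ?thesis
      using a by (auto intro: set_multI)
  qed
  have multN: "b \<otimes> n \<in> ?B" if b: "b \<in> ?B" and n: "n \<in> N" for b n
  proof -
    obtain a m where a: "a \<in> P 2 \<inter> S" "m \<in> N" "b = a \<otimes> m"
      using b by (blast elim: set_multE)
    have "a \<otimes> (m \<otimes> n) \<in> ?B"
      using a n subgroup.m_closed[OF Ns] by (intro set_multI) auto
    moreover have "a \<in> carrier G" "m \<in> carrier G" "n \<in> carrier G"
      using a n carS carN by auto
    ultimately show ?thesis
      using a(3) by (simp add: m_assoc)
  qed
  have N_sub: "N \<subseteq> ?B"
  proof
    fix n assume n: "n \<in> N"
    have "\<one> \<otimes> n \<in> ?B"
      using n one_in_P subgroup.one_closed[OF Ss] by (intro set_multI) auto
    then show "n \<in> ?B" using n carN by auto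
  qed
  have B_sub: "?B \<subseteq> S"
    using S(2) subgroup.m_closed[OF Ss] by (auto simp: set_mult_def)
  have Bs: "subgroup ?B G"
  proof (rule subgroupI)
    show "?B \<subseteq> carrier G" using B_sub carS by blast
    show "?B \<noteq> {}" using N_sub subgroup.one_closed[OF Ns] by blast
  next
    fix b assume "b \<in> ?B"
    then obtain a n where a: "a \<in> P 2" "a \<in> S" "n \<in> N" "b = a \<otimes> n"
      by (blast elim: set_multE)
    have "inv a \<in> ?B"
      using a P_inv P_mono[of 2 6] subgroup.m_inv_closed[OF Ss] by (intro P6) auto
    moreover have "a \<otimes> inv n \<otimes> inv a \<in> N"
      using a SC normal_in_conj[OF N] subgroup.m_inv_closed[OF Ns] by blast
    ultimately have "inv a \<otimes> (a \<otimes> inv n \<otimes> inv a) \<in> ?B"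
      by (rule multN)
    moreover have "n \<in> carrier G" "a \<in> carrier G" using a carN carS by auto
    ultimately show "inv b \<in> ?B"
      using a(4) by (simp add: group_word)
  next
    fix b b' assume "b \<in> ?B" "b' \<in> ?B"
    then obtain a n a' n' where a: "a \<in> P 2" "a \<in> S" "n \<in> N" "b = a \<otimes> n"
      "a' \<in> P 2" "a' \<in> S" "n' \<in> N" "b' = a' \<otimes> n'"
      by (blast elim: set_multE)
    have "a \<otimes> a' \<in> P (2 + 2)" using a P_mult by blast
    then have "a \<otimes> a' \<in> ?B"
      using a P_mono[of "2 + 2" 6] subgroup.m_closed[OF Ss] by (intro P6) auto
    moreover have "inv a' \<otimes> n \<otimes> a' \<in> N"
      using a SC normal_in_conj_inv[OF N C(1)] by blast
    then have "inv a' \<otimes> n \<otimes> a' \<otimes> n' \<in> N"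
      using a subgroup.m_closed[OF Ns] by blast
    ultimately have "(a \<otimes> a') \<otimes> (inv a' \<otimes> n \<otimes> a' \<otimes> n') \<in> ?B"
      by (rule multN)
    moreover have "n \<in> carrier G" "a \<in> carrier G" "n' \<in> carrier G" "a' \<in> carrier G"
      using a carN carS by auto
    ultimately show "b \<otimes> b' \<in> ?B"
      using a(4,8) by (simp add: group_word)
  qed
  have "normal_in ?B (generate G ((P 2 \<inter> C) \<union> N))"
  proof (rule normal_in_generate[OF Bs])
    show "?B \<subseteq> generate G ((P 2 \<inter> C) \<union> N)"
      unfolding C(2)[symmetric] using B_sub SC by blast
    show "(P 2 \<inter> C) \<union> N \<subseteq> carrier G" using carN carC by blast
    show "inv c \<in> (P 2 \<inter> C) \<union> N" if "c \<in> (P 2 \<inter> C) \<union> N" for c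
      using that P_inv subgroup.m_inv_closed[OF C(1)] subgroup.m_inv_closed[OF Ns] by blast
    fix c x assume "c \<in> (P 2 \<inter> C) \<union> N" and x: "x \<in> ?B"
    then consider "c \<in> N" | "c \<in> P 2" "c \<in> C" by blast
    then show "c \<otimes> x \<otimes> inv c \<in> ?B"
    proof cases
      case 1
      then show ?thesis using N_sub x subgroup_conj[OF Bs] by blast
    next
      case 2
      obtain a n where a: "a \<in> P 2" "a \<in> S" "n \<in> N" "x = a \<otimes> n"
        using x by (blast elim: set_multE)
      have "c \<otimes> a \<otimes> inv c \<in> P (2 + 2 + 2)"
        using P_conj[OF 2(1) a(1)] .
      then have "c \<otimes> a \<otimes> inv c \<in> ?B"
        using normal_in_conj[OF S(1) 2(2) a(2)] by (intro P6) simp_all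
      then have "(c \<otimes> a \<otimes> inv c) \<otimes> (c \<otimes> n \<otimes> inv c) \<in> ?B"
        using normal_in_conj[OF N 2(2) a(3)] by (rule multN)
      moreover have "n \<in> carrier G" "a \<in> carrier G" "c \<in> carrier G"
        using a 2 carN carS carC by auto
      ultimately show ?thesis
        using a(4) by (simp add: group_word)
    qed
  qed
  then show ?thesis using C(2) by simp
qed

end

section \<open>A quantitative Schur theorem\<close>

lemma last_index_exists:
  fixes Q :: "nat \<Rightarrow> bool"
  assumes "Q 0" "\<not> Q n"
  shows "\<exists>k. Q k \<and> \<not> Q (Suc k)"
  using assms by (induction n) auto

context approximate_group
begin

text \<open>As [f,c] is central modulo \<open>Q\<close>, the map from f to [f,c] is a homomorphism
  of \<open>F\<close> into the center of C/Q. Its image is a central, hence normal, subgroup, and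
  \<open>?E\<close> is the preimage.\<close>

lemma commutator_cosets_normal_in:
  assumes C: "subgroup C G" and Q: "normal_in Q C" and F: "normal_in F C" and c: "c \<in> C"
    and Z: "\<And>f d. f \<in> F \<Longrightarrow> d \<in> C \<Longrightarrow> commutator (commutator f c) d \<in> Q"
  shows "normal_in {e \<in> C. \<exists>f\<in>F. \<exists>q\<in>Q. e = q \<otimes> commutator f c} C" (is "normal_in ?E C")
proof -
  note Qs = normal_in_subgroup[OF Q] and Fs = normal_in_subgroup[OF F]
  have car: "x \<in> carrier G" if "x \<in> C" for x
    using subgroup.mem_carrier[OF C that] .
  have FC: "F \<subseteq> C" and QC: "Q \<subseteq> C" using F Q by (auto simp: normal_in_def)
  have comC: "commutator f c \<in> C" if "f \<in> F" for f
    using that FC c subgroup_commutator[OF C] by blast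
  have sub: "subgroup ?E G"
  proof (rule subgroupI)
    show "?E \<subseteq> carrier G" using car by blast
    have "\<one> = \<one> \<otimes> commutator \<one> c"
      using car[OF c] by (simp add: commutator_def)
    then have "\<one> \<in> ?E"
      using subgroup.one_closed[OF Qs] subgroup.one_closed[OF Fs] subgroup.one_closed[OF C] by blast
    then show "?E \<noteq> {}" by blast
  next
    fix e assume "e \<in> ?E"
    then obtain f q where e: "e \<in> C" "f \<in> F" "q \<in> Q" "e = q \<otimes> commutator f c" by blast
    have fi: "inv f \<in> F" using e subgroup.m_inv_closed[OF Fs] by blast
    let ?k = "commutator f c"
    have cars: "f \<in> carrier G" "q \<in> carrier G" "c \<in> carrier G" "?k \<in> carrier G"
      using e FC QC c car comC by auto
    have eq: "commutator (inv f) c = commutator (inv f) (inv ?k) \<otimes> inv ?k"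
      unfolding commutator_inv_left[OF cars(1,3)]
      using conj_eq_commutator_mult[of "inv f" "inv ?k"] cars by simp
    have "commutator ?k (inv f) \<in> Q"
      using Z[OF e(2)] fi FC by blast
    then have "inv ?k \<otimes> inv (commutator ?k (inv f)) \<otimes> ?k \<in> Q"
      using normal_in_conj_inv[OF Q C comC[OF e(2)]] subgroup.m_inv_closed[OF Qs] by blast
    then have "commutator (inv ?k) (inv f) \<in> Q"
      using cars by (simp add: commutator_inv_left)
    then have 1: "commutator (inv f) (inv ?k) \<in> Q"
      using commutator_swap[OF Qs] cars by simp
    have 2: "inv ?k \<otimes> inv q \<otimes> inv (inv ?k) \<in> Q"
      using e comC subgroup.m_inv_closed[OF C] subgroup.m_inv_closed[OF Qs]
      by (intro normal_in_conj[OF Q]) auto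
    have "inv e = (inv ?k \<otimes> inv q \<otimes> inv (inv ?k)) \<otimes> inv (commutator (inv f) (inv ?k))
        \<otimes> commutator (inv f) c"
      unfolding eq e(4) using cars commutator_closed[of "inv f" "inv ?k"] by (simp add: group_word)
    moreover have "(inv ?k \<otimes> inv q \<otimes> inv (inv ?k)) \<otimes> inv (commutator (inv f) (inv ?k)) \<in> Q"
      using 1 2 subgroup.m_closed[OF Qs] subgroup.m_inv_closed[OF Qs] by blast
    ultimately show "inv e \<in> ?E"
      using fi subgroup.m_inv_closed[OF C e(1)] by blast
  next
    fix e e' assume "e \<in> ?E" "e' \<in> ?E"
    then obtain f q f' q' where e: "e \<in> C" "f \<in> F" "q \<in> Q" "e = q \<otimes> commutator f c"
      "e' \<in> C" "f' \<in> F" "q' \<in> Q" "e' = q' \<otimes> commutator f' c" by blast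
    let ?k = "commutator f c" and ?k' = "commutator f' c"
    have cars: "f \<in> carrier G" "q \<in> carrier G" "c \<in> carrier G" "?k \<in> carrier G"
      "f' \<in> carrier G" "q' \<in> carrier G" "?k' \<in> carrier G"
      using e FC QC c car comC by auto
    \<comment> \<open>The order f' f produces \<open>?k\<close> before \<open>?k'\<close>, as in e
      e'.\<close>
    have "commutator (f' \<otimes> f) c = f' \<otimes> ?k \<otimes> inv f' \<otimes> ?k'"
      using commutator_mult_left[OF cars(5,1,3)] .
    also have "\<dots> = commutator f' ?k \<otimes> ?k \<otimes> ?k'"
      using conj_eq_commutator_mult[of f' ?k] cars by simp
    finally have eq: "commutator (f' \<otimes> f) c = commutator f' ?k \<otimes> ?k \<otimes> ?k'" .
    have "commutator ?k f' \<in> Q"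
      using Z[OF e(2)] e FC by blast
    then have 1: "commutator f' ?k \<in> Q"
      using commutator_swap[OF Qs] cars by simp
    have 2: "?k \<otimes> q' \<otimes> inv ?k \<in> Q"
      using e comC by (intro normal_in_conj[OF Q]) auto
    have "e \<otimes> e' = (q \<otimes> (?k \<otimes> q' \<otimes> inv ?k) \<otimes> inv (commutator f' ?k)) \<otimes> commutator (f' \<otimes> f) c"
      unfolding eq e(4,8) using cars commutator_closed[of f' ?k] by (simp add: group_word)
    moreover have "q \<otimes> (?k \<otimes> q' \<otimes> inv ?k) \<otimes> inv (commutator f' ?k) \<in> Q"
      by (intro subgroup.m_closed[OF Qs] subgroup.m_inv_closed[OF Qs] 1 2 e)
    moreover have "f' \<otimes> f \<in> F" using e subgroup.m_closed[OF Fs] by blast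
    ultimately show "e \<otimes> e' \<in> ?E"
      using subgroup.m_closed[OF C e(1,5)] by blast
  qed
  moreover have "d \<otimes> e \<otimes> inv d \<in> ?E" if d: "d \<in> C" and eE: "e \<in> ?E" for d e
  proof -
    obtain f q where e: "e \<in> C" "f \<in> F" "q \<in> Q" "e = q \<otimes> commutator f c" using eE by blast
    let ?k = "commutator f c"
    have cars: "f \<in> carrier G" "q \<in> carrier G" "c \<in> carrier G" "?k \<in> carrier G" "d \<in> carrier G"
      using e FC QC c car comC d by auto
    have "commutator ?k d \<in> Q" using Z[OF e(2) d] .
    then have 1: "commutator d ?k \<in> Q"
      using commutator_swap[OF Qs] cars by simp
    have "d \<otimes> e \<otimes> inv d = (d \<otimes> q \<otimes> inv d) \<otimes> (d \<otimes> ?k \<otimes> inv d)"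
      unfolding e(4) using cars by (simp add: group_word)
    also have "\<dots> = ((d \<otimes> q \<otimes> inv d) \<otimes> commutator d ?k) \<otimes> ?k"
      using conj_eq_commutator_mult[of d ?k] cars commutator_closed[of d ?k] by (simp add: group_word)
    finally have "d \<otimes> e \<otimes> inv d = ((d \<otimes> q \<otimes> inv d) \<otimes> commutator d ?k) \<otimes> ?k" .
    moreover have "(d \<otimes> q \<otimes> inv d) \<otimes> commutator d ?k \<in> Q"
      using 1 normal_in_conj[OF Q d e(3)] subgroup.m_closed[OF Qs] by blast
    ultimately show ?thesis
      using e(2) subgroup_conj[OF C d e(1)] by blast
  qed
  ultimately show ?thesis
    unfolding normal_in_def by blast
qed

text \<open>The candidates may be infinite, so the count of elements in \<open>P 2\<close> is
  maximised instead. Nested candidates with equal trace on \<open>P 2\<close> coincide, since both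
  contain \<open>Q0\<close> and lie in \<open>P 2 <#> Q0\<close>.\<close>

lemma maximal_normal_in_power_mult:
  assumes "normal_in Q0 C" "Q0 \<subseteq> H1"
  obtains Q where "normal_in Q C" "Q0 \<subseteq> Q" "Q \<subseteq> H1" "Q \<subseteq> P 2 <#> Q0"
    "\<And>E. normal_in E C \<Longrightarrow> Q \<subseteq> E \<Longrightarrow> E \<subseteq> H1 \<Longrightarrow> E \<subseteq> P 2 <#> Q0 \<Longrightarrow> E = Q"
proof -
  define ok where "ok Q \<longleftrightarrow> normal_in Q C \<and> Q0 \<subseteq> Q \<and> Q \<subseteq> H1 \<and> Q \<subseteq> P 2 <#> Q0" for Q
  have Q0s: "subgroup Q0 G" using assms normal_in_subgroup by blast
  have "ok Q0"
    unfolding ok_def using assms subset_P_mult_set[OF subgroup.subset[OF Q0s]] by auto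
  moreover have "\<forall>Q. ok Q \<longrightarrow> card (Q \<inter> P 2) < Suc (card (P 2))"
    by (auto simp: less_Suc_eq_le intro: card_mono finite_P)
  ultimately have "\<exists>Q. ok Q \<and> (\<forall>E. ok E \<longrightarrow> card (E \<inter> P 2) \<le> card (Q \<inter> P 2))"
    by (rule ex_has_greatest_nat)
  then obtain Q where Q: "ok Q" "\<And>E. ok E \<Longrightarrow> card (E \<inter> P 2) \<le> card (Q \<inter> P 2)"
    by auto
  have "E = Q" if E: "normal_in E C" "Q \<subseteq> E" "E \<subseteq> H1" "E \<subseteq> P 2 <#> Q0" for E
  proof
    have "ok E" using E Q(1) by (auto simp: ok_def)
    then have "card (E \<inter> P 2) \<le> card (Q \<inter> P 2)" by (rule Q)
    then have eq: "E \<inter> P 2 = Q \<inter> P 2"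
      using E(2) finite_P by (intro card_seteq[symmetric] finite_Int disjI2) auto
    have Es: "subgroup E G" and Qs: "subgroup Q G"
      using E Q by (auto simp: normal_in_def ok_def)
    show "E \<subseteq> Q"
    proof
      fix e assume e: "e \<in> E"
      then obtain a q where a: "a \<in> P 2" "q \<in> Q0" "e = a \<otimes> q"
        using E(4) by (blast elim: set_multE)
      have qQ: "q \<in> Q" using a Q(1) by (auto simp: ok_def)
      have "a = e \<otimes> inv q"
        using a P_carrier[of a 2] subgroup.mem_carrier[OF Qs qQ] by (simp add: m_assoc)
      then have "a \<in> E"
        using e qQ E(2) subgroup.m_closed[OF Es] subgroup.m_inv_closed[OF Es] by blast
      then show "e \<in> Q"
        using eq a qQ subgroup.m_closed[OF Qs] by blast
    qed
  qed (use E in simp)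
  then show ?thesis
    using that[of Q] Q(1) unfolding ok_def by blast
qed

lemma commutator_mod_normal:
  assumes C: "subgroup C G" and Q: "normal_in Q C" and "a \<in> C" "n \<in> C" "c \<in> C"
    and "commutator n c \<in> Q"
  shows "\<exists>q\<in>Q. commutator (a \<otimes> n) c = q \<otimes> commutator a c"
  using commutator_mult_left[of a n c] normal_in_conj[OF Q \<open>a \<in> C\<close> assms(6)]
    subgroup.mem_carrier[OF C] assms(3-5) by auto

text \<open>Nilpotency of \<open>C\<close> modulo \<open>N\<close> serves only to find elements that are central modulo
  the center; the length of the upper central series does not affect the bound. In \<open>r\<close>, the
  summand \<open>2 * m + 12\<close> is the length of a commutator of elements of \<open>P m\<close> and \<open>P 6\<close>, and
  2 accounts for the passage from \<open>Q\<close> to \<open>Q0\<close>.\<close>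

lemma central_by_bounded_step:
  fixes m :: nat
  defines "r \<equiv> 2 * m + 14"
  assumes C: "subgroup C G" "C = generate G ((P 6 \<inter> C) \<union> N)" and N: "normal_in N C"
    and nil: "upper_central C N n = C"
    and H1: "normal_in H1 C" and N1: "N1 \<subseteq> H1" "subgroup N1 G"
    and bound: "H1 \<subseteq> P m <#> N1"
    and Q0: "normal_in Q0 C" "N \<subseteq> Q0" "Q0 \<subseteq> H1"
    and cent: "\<And>x c. x \<in> N1 \<Longrightarrow> c \<in> C \<Longrightarrow> commutator x c \<in> Q0"
    and U: "separated U" "U \<subseteq> P r \<inter> Q0" "K ^ r < real (card U) + real j"
  shows "\<exists>H. normal_in H C \<and> Q0 \<subseteq> H \<and> H \<subseteq> P (r * j + 2) <#> Q0 \<and>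
    (\<forall>x\<in>H1. \<forall>c\<in>C. commutator x c \<in> H)"
  using Q0 cent U
proof (induction j arbitrary: Q0 U)
  case 0
  \<comment> \<open>With no rounds left, \<open>U\<close> would exceed Gleason's bound.\<close>
  then show ?case using card_separated_le[of U r] by auto
next
  case (Suc j)
  note Q0 = Suc.prems(1-3) and cent = Suc.prems(4) and U = Suc.prems(5-7)
  \<comment> \<open>By maximality, every strictly larger normal subgroup inside \<open>H1\<close>
    leaves \<open>P 2 <#> Q0\<close> and so provides a new element for \<open>U\<close>.\<close>
  obtain Q where Q: "normal_in Q C" "Q0 \<subseteq> Q" "Q \<subseteq> H1" "Q \<subseteq> P 2 <#> Q0"
    and max: "\<And>E. normal_in E C \<Longrightarrow> Q \<subseteq> E \<Longrightarrow> E \<subseteq> H1 \<Longrightarrow> E \<subseteq> P 2 <#> Q0 \<Longrightarrow> E = Q"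
    using maximal_normal_in_power_mult[OF Q0(1,3)] by blast
  note Qs = normal_in_subgroup[OF Q(1)] and H1s = normal_in_subgroup[OF H1]
    and Q0s = normal_in_subgroup[OF Q0(1)]
  have car: "x \<in> carrier G" if "x \<in> C" for x
    using subgroup.mem_carrier[OF C(1) that] .
  have H1C: "H1 \<subseteq> C" and Q0C: "Q0 \<subseteq> carrier G"
    using H1 subgroup.subset[OF Q0s] by (auto simp: normal_in_def)
  show ?case
  proof (cases "H1 \<subseteq> center_mod C Q")
    case True
    have "P 2 <#> Q0 \<subseteq> P (r * Suc j + 2) <#> Q0"
      by (rule P_mult_set_mono) simp
    then show ?thesis
      using Q True by (intro exI[of _ Q]) (auto simp: center_mod_def)
  next
    case False
    \<comment> \<open>\<open>Z\<close> is the part of \<open>H1\<close> central modulo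
      \<open>Q\<close>, and \<open>F\<close> the part central modulo \<open>Z\<close>. For f in
      \<open>F\<close>, [f,c] is then central modulo \<open>Q\<close>.\<close>
    define Z where "Z = H1 \<inter> center_mod C Q"
    define F where "F = H1 \<inter> center_mod C Z"
    have Z: "normal_in Z C"
      unfolding Z_def by (intro normal_in_Int H1 center_mod_normal_in C Q)
    have F: "normal_in F C"
      unfolding F_def by (intro normal_in_Int H1 center_mod_normal_in C Z)
    have "\<not> H1 \<inter> upper_central C N n \<subseteq> Z"
      using False nil H1C by (auto simp: Z_def)
    moreover have "H1 \<inter> upper_central C N 0 \<subseteq> Z"
      using Q0(2) Q(2) subset_center_mod[OF C(1) Q(1)] by (auto simp: Z_def)
    \<comment> \<open>Where the upper central series leaves \<open>Z\<close>, a new element h has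
      all its commutators with \<open>C\<close> in \<open>Z\<close>; so h lies in \<open>F\<close>
      but not in \<open>Z\<close>.\<close>
    ultimately obtain k where k: "H1 \<inter> upper_central C N k \<subseteq> Z" "\<not> H1 \<inter> upper_central C N (Suc k) \<subseteq> Z"
      using last_index_exists[of "\<lambda>k. H1 \<inter> upper_central C N k \<subseteq> Z" n] by blast
    then obtain h where h: "h \<in> H1" "h \<in> upper_central C N (Suc k)" "h \<notin> Z" by blast
    have "h \<in> F"
      using h k(1) H1C normal_in_commutator(1)[OF H1 C(1) h(1)] by (auto simp: F_def center_mod_def)
    \<comment> \<open>Not being central modulo \<open>Q\<close>, h fails to commute with some
      generator c of \<open>C\<close>. Elements of \<open>N\<close> are excluded, so c lies in
      \<open>P 6\<close>; this keeps the commutators below short.\<close>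
    have "\<not> C \<subseteq> {c \<in> C. commutator c h \<in> Q}"
    proof
      assume *: "C \<subseteq> {c \<in> C. commutator c h \<in> Q}"
      have "commutator h c \<in> Q" if "c \<in> C" for c
        using that * car h(1) H1C commutator_swap[OF Qs, of c h] by auto
      then show False
        using h H1C by (auto simp: Z_def center_mod_def)
    qed
    moreover have "subgroup {c \<in> C. commutator c h \<in> Q} G"
      using h H1C by (intro centralizer_subgroup C Q) auto
    ultimately have "\<not> (P 6 \<inter> C) \<union> N \<subseteq> {c \<in> C. commutator c h \<in> Q}"
      using C(2) generate_subgroup_incl by metis
    then obtain c where c': "c \<in> (P 6 \<inter> C) \<union> N" "c \<notin> {c \<in> C. commutator c h \<in> Q}"
      by (meson subsetI)
    moreover have "c \<in> C"
      using c'(1) normal_in_subset[OF N] by blast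
    moreover have "c \<notin> N"
    proof
      assume "c \<in> N"
      then have "commutator c h \<in> Q"
        using Q0(2) Q(2) h(1) H1C by (intro normal_in_commutator(1)[OF Q(1) C(1)]) auto
      then show False
        using c'(2) \<open>c \<in> C\<close> by simp
    qed
    ultimately have c: "c \<in> P 6" "c \<in> C" "commutator c h \<notin> Q"
      by auto
    have chQ: "commutator h c \<notin> Q"
      using c commutator_swap[OF Qs, of h c] car h(1) H1C by auto
    define E where "E = {e \<in> C. \<exists>f\<in>F. \<exists>q\<in>Q. e = q \<otimes> commutator f c}"
    have E: "normal_in E C"
      unfolding E_def
    proof (rule commutator_cosets_normal_in[OF C(1) Q(1) F c(2)])
      show "commutator (commutator f c) d \<in> Q" if "f \<in> F" "d \<in> C" for f d
        using that c(2) by (auto simp: F_def Z_def center_mod_def)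
    qed
    have EI: "q \<otimes> commutator f c \<in> E" if "q \<in> Q" "f \<in> F" for q f
    proof -
      have "q \<otimes> commutator f c \<in> C"
        using that c(2) normal_in_subset[OF F] normal_in_subset[OF Q(1)]
          subgroup_commutator[OF C(1)] subgroup.m_closed[OF C(1)] by blast
      then show ?thesis using that by (auto simp: E_def)
    qed
    have QE: "Q \<subseteq> E"
    proof
      fix q assume q: "q \<in> Q"
      have "commutator \<one> c = \<one>" using car[OF c(2)] by (simp add: commutator_def)
      then show "q \<in> E"
        using EI[OF q, of \<one>] subgroup.one_closed[OF normal_in_subgroup[OF F]]
          subgroup.mem_carrier[OF Qs q] by simp
    qed
    have EH1: "E \<subseteq> H1"
    proof
      fix e assume "e \<in> E"
      then obtain f q where "f \<in> F" "q \<in> Q" "e = q \<otimes> commutator f c" by (auto simp: E_def)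
      moreover from this have "commutator f c \<in> H1"
        using normal_in_commutator(1)[OF H1 C(1) _ c(2)] by (auto simp: F_def)
      ultimately show "e \<in> H1"
        using Q(3) subgroup.m_closed[OF H1s] by blast
    qed
    have com_P: "\<exists>q\<in>Q. commutator f c = q \<otimes> commutator a c" if "f = a \<otimes> x" "a \<in> C" "x \<in> N1" for f a x
      unfolding that(1)
    proof (rule commutator_mod_normal[OF C(1) Q(1) that(2) _ c(2)])
      show "x \<in> C" using that N1 H1C by blast
      show "commutator x c \<in> Q" using that cent c Q(2) by blast
    qed
    \<comment> \<open>Write f = a x with a in \<open>P m\<close> and x in \<open>N1\<close>. As
      [x,c] lies in \<open>Q\<close>, [f,c] agrees modulo \<open>Q\<close> with [a,c], a word of
      length 2m + 12.\<close>
    have "E \<subseteq> P (r - 2) <#> Q"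
    proof
      fix e assume "e \<in> E"
      then obtain f q where e: "f \<in> F" "q \<in> Q" "e = q \<otimes> commutator f c" by (auto simp: E_def)
      then obtain a x where a: "a \<in> P m" "x \<in> N1" "f = a \<otimes> x"
        using bound by (auto simp: F_def elim!: set_multE dest!: subsetD)
      have "a = f \<otimes> inv x"
        using a P_carrier[of a m] subgroup.mem_carrier[OF N1(2)] by (simp add: m_assoc)
      then have aH: "a \<in> H1"
        using e(1) a(2) N1 subgroup.m_closed[OF H1s] subgroup.m_inv_closed[OF H1s] by (auto simp: F_def)
      obtain q' where q': "q' \<in> Q" "commutator f c = q' \<otimes> commutator a c"
        using com_P[OF a(3) _ a(2)] aH H1C by blast
      let ?k = "commutator a c"
      have k: "?k \<in> C" using aH H1C c(2) subgroup_commutator[OF C(1)] by blast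
      have "?k \<in> P (m + 6 + m + 6)" using P_commutator a(1) c(1) .
      moreover have "m + 6 + m + 6 = r - 2" by (simp add: r_def)
      ultimately have kP: "?k \<in> P (r - 2)" by metis
      have "inv ?k \<otimes> (q \<otimes> q') \<otimes> ?k \<in> Q"
        using normal_in_conj_inv[OF Q(1) C(1) k] subgroup.m_closed[OF Qs e(2) q'(1)] by blast
      then have "?k \<otimes> (inv ?k \<otimes> (q \<otimes> q') \<otimes> ?k) \<in> P (r - 2) <#> Q"
        using kP by (intro set_multI)
      moreover have "e = ?k \<otimes> (inv ?k \<otimes> (q \<otimes> q') \<otimes> ?k)"
        unfolding e(3) q'(2)
        using car[OF k] subgroup.mem_carrier[OF Qs e(2)] subgroup.mem_carrier[OF Qs q'(1)]
        by (simp add: group_word)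
      ultimately show "e \<in> P (r - 2) <#> Q" by simp
    qed
    then have "E \<subseteq> P (r - 2 + 2) <#> Q0"
      using Q(4) Q0C by (rule set_power_mult_assoc)
    moreover have "r - 2 + 2 = r" by (simp add: r_def)
    ultimately have E_r: "E \<subseteq> P r <#> Q0" by metis
    have "h \<in> F" by fact
    then have "\<one> \<otimes> commutator h c \<in> E"
      by (intro EI subgroup.one_closed[OF Qs])
    then have "commutator h c \<in> E"
      using commutator_closed car c(2) h(1) H1C by auto
    then have "E \<noteq> Q" using chQ by blast
    \<comment> \<open>Maximality of \<open>Q\<close> applies because \<open>E\<close> contains
      [h,c]. The element u found outside \<open>P 2 <#> Q0\<close> can be taken in
      \<open>P r\<close> by dropping a factor in \<open>Q0\<close>.\<close>
    then have "\<not> E \<subseteq> P 2 <#> Q0" using max[OF E QE EH1] by blast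
    then obtain e where e: "e \<in> E" "e \<notin> P 2 <#> Q0" by blast
    obtain u q where u: "u \<in> P r" "q \<in> Q0" "e = u \<otimes> q"
      using e(1) E_r by (blast elim: set_multE)
    have carq: "q \<in> carrier G" "u \<in> carrier G" using u Q0C P_carrier by auto
    note Es = normal_in_subgroup[OF E]
    have "u = e \<otimes> inv q" using u(3) carq by (simp add: m_assoc)
    then have uE: "u \<in> E"
      using e(1) u(2) Q(2) QE subgroup.m_closed[OF Es] subgroup.m_inv_closed[OF Es] by blast
    have uQ0: "u \<notin> P 2 <#> Q0"
    proof
      assume "u \<in> P 2 <#> Q0"
      then obtain a q' where a: "a \<in> P 2" "q' \<in> Q0" "u = a \<otimes> q'" by (blast elim: set_multE)
      then have "a \<otimes> (q' \<otimes> q) \<in> P 2 <#> Q0"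
        using u(2) subgroup.m_closed[OF Q0s] by (intro set_multI) auto
      moreover have "a \<in> carrier G" "q' \<in> carrier G" using a Q0C P_carrier by auto
      ultimately show False using e(2) u(3) a(3) carq by (simp add: m_assoc)
    qed
    have U_sub: "U \<subseteq> Q0" using U by blast
    note ins = separated_insert[OF U(1) Q0s U_sub carq(2) uQ0]
    have finU: "finite U" using U(2) finite_P finite_subset by blast
    \<comment> \<open>The next round starts from \<open>E\<close> in place of \<open>Q0\<close>, and
      each round adds r to the length.\<close>
    have "\<exists>H. normal_in H C \<and> E \<subseteq> H \<and> H \<subseteq> P (r * j + 2) <#> E \<and>
        (\<forall>x\<in>H1. \<forall>c\<in>C. commutator x c \<in> H)"
    proof (rule Suc.IH[OF E _ EH1 _ ins(1)])
      show "N \<subseteq> E" using Q0(2) Q(2) QE by blast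
      show "commutator x d \<in> E" if "x \<in> N1" "d \<in> C" for x d
        using cent[OF that] Q(2) QE by blast
      show "insert u U \<subseteq> P r \<inter> E" using u(1) uE U(2) Q(2) QE by blast
      show "K ^ r < real (card (insert u U)) + real j"
        using U(3) finU ins(2) by simp
    qed
    then obtain H where H: "normal_in H C" "E \<subseteq> H" "H \<subseteq> P (r * j + 2) <#> E"
      "\<forall>x\<in>H1. \<forall>c\<in>C. commutator x c \<in> H" by blast
    have "H \<subseteq> P (r * j + 2 + r) <#> Q0"
      using H(3) E_r Q0C by (rule set_power_mult_assoc)
    then have "H \<subseteq> P (r * Suc j + 2) <#> Q0" by (simp add: algebra_simps)
    then show ?thesis
      using H Q(2) QE by blast
  qed
qed

text \<open>The iteration starts from the empty separated set with more rounds than Gleason's bound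
  K^r allows, so the length of \<open>H\<close> over \<open>B\<close> depends only on
  \<open>m\<close> and \<open>K\<close>.\<close>

lemma central_by_bounded:
  fixes m :: nat
  defines "r \<equiv> 2 * m + 14"
  assumes C: "subgroup C G" "C = generate G ((P 6 \<inter> C) \<union> N)" and N: "normal_in N C"
    and nil: "upper_central C N n = C"
    and H1: "normal_in H1 C" and N1: "N1 \<subseteq> H1" "subgroup N1 G"
    and bound: "H1 \<subseteq> P m <#> N1"
    and B: "normal_in B C" "N \<subseteq> B" "B \<subseteq> H1"
    and cent: "\<And>x c. x \<in> N1 \<Longrightarrow> c \<in> C \<Longrightarrow> commutator x c \<in> B"
  shows "\<exists>H. normal_in H C \<and> B \<subseteq> H \<and> H \<subseteq> P (r * nat \<lceil>K ^ r + 1\<rceil> + 2) <#> B \<and>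
    (\<forall>x\<in>H1. \<forall>c\<in>C. commutator x c \<in> H)"
proof -
  have "K ^ r < real (card {}) + real (nat \<lceil>K ^ r + 1\<rceil>)"
    using K_ge_1 by (simp, linarith)
  then show ?thesis
    using central_by_bounded_step[OF C N nil H1 N1 bound B cent, of "{}" "nat \<lceil>K ^ r + 1\<rceil>"]
    by (simp add: separated_def r_def)
qed

end

section \<open>Nilpotent quotients\<close>

text \<open>The base value 2 comes from H = (A^2 \<inter> C)N. In the recursion, r is that of
  \<open>central_by_bounded\<close>, and 4 consists of its summand 2 and the length 2 of
  \<open>B\<close> over \<open>N\<close>.\<close>

primrec power_bound :: "real \<Rightarrow> nat \<Rightarrow> nat" where
  "power_bound K 0 = 2"
| "power_bound K (Suc s) =
    (let r = 2 * power_bound K s + 14 in r * nat \<lceil>K ^ r + 1\<rceil> + 4)"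

context approximate_group
begin

section \<open>Coset counts along a chain of subgroups\<close>

definition coset_cover :: "'a \<Rightarrow> 'a set \<Rightarrow> 'a set \<Rightarrow> real \<Rightarrow> bool" where
  "coset_cover g C D t \<longleftrightarrow> (\<exists>F. F \<subseteq> carrier G \<and> finite F \<and> real (card F) \<le> t \<and>
     (\<forall>a\<in>A. inv g \<otimes> a \<in> C \<longrightarrow> (\<exists>f\<in>F. inv f \<otimes> a \<in> D)))"

lemma coset_cover_refl: "g \<in> carrier G \<Longrightarrow> 1 \<le> t \<Longrightarrow> coset_cover g C C t"
  unfolding coset_cover_def by (rule exI[of _ "{g}"]) auto

text \<open>Since only the part of \<open>A\<close> in one coset is covered, each coset of
  \<open>D\<close> can be refined separately, and the counts multiply.\<close>

lemma coset_cover_trans: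
  assumes "coset_cover g C D t" "\<And>f. f \<in> carrier G \<Longrightarrow> coset_cover f D E t'" "0 \<le> t'"
  shows "coset_cover g C E (t * t')"
proof -
  obtain F where F: "F \<subseteq> carrier G" "finite F" "real (card F) \<le> t"
    "\<forall>a\<in>A. inv g \<otimes> a \<in> C \<longrightarrow> (\<exists>f\<in>F. inv f \<otimes> a \<in> D)"
    using assms(1) by (auto simp: coset_cover_def)
  have "\<forall>f\<in>F. \<exists>F'. F' \<subseteq> carrier G \<and> finite F' \<and> real (card F') \<le> t' \<and>
     (\<forall>a\<in>A. inv f \<otimes> a \<in> D \<longrightarrow> (\<exists>f\<in>F'. inv f \<otimes> a \<in> E))"
    using assms(2) F(1) unfolding coset_cover_def by blast
  then obtain \<Phi> where \<Phi>: "\<forall>f\<in>F. \<Phi> f \<subseteq> carrier G \<and> finite (\<Phi> f) \<and> real (card (\<Phi> f)) \<le> t' \<and>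
     (\<forall>a\<in>A. inv f \<otimes> a \<in> D \<longrightarrow> (\<exists>f\<in>\<Phi> f. inv f \<otimes> a \<in> E))"
    by (rule bchoice[THEN exE])
  have "real (card (\<Union>f\<in>F. \<Phi> f)) \<le> (\<Sum>f\<in>F. real (card (\<Phi> f)))"
    using card_UN_le[OF F(2), of \<Phi>] by (metis of_nat_le_iff of_nat_sum)
  also have "\<dots> \<le> (\<Sum>f\<in>F. t')"
    using \<Phi> by (intro sum_mono) auto
  also have "\<dots> \<le> t * t'"
    using F(3) assms(3) by (simp add: mult_right_mono)
  finally show ?thesis
    unfolding coset_cover_def using F \<Phi> by (intro exI[of _ "\<Union>f\<in>F. \<Phi> f"]) fastforce
qed

text \<open>Fix b in \<open>A\<close> and in gC. The commutators [b^-1 a, u] lie in A^16 and in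
  \<open>S\<close>, so they meet at most K^15 cosets of \<open>B\<close>. If a and f yield the same
  coset, f^-1 a lies in \<open>P 2\<close>, in \<open>C\<close>, and centralises u modulo
  \<open>B\<close>.\<close>

lemma coset_cover_centralizer:
  assumes C: "subgroup C G" and S: "subgroup S G" and B: "normal_in B C" "P 2 \<inter> S \<subseteq> B"
    and u: "u \<in> P 6" "u \<in> C" "\<And>c. c \<in> C \<Longrightarrow> commutator c u \<in> S"
    and D: "\<And>c. c \<in> P 2 \<Longrightarrow> c \<in> C \<Longrightarrow> commutator c u \<in> B \<Longrightarrow> c \<in> D"
    and g: "g \<in> carrier G"
  shows "coset_cover g C D (K ^ 15)"
proof (cases "\<exists>b\<in>A. inv g \<otimes> b \<in> C")
  case False
  then show ?thesis
    unfolding coset_cover_def using K_ge_1 by (intro exI[of _ "{}"]) auto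
next
  case True
  then obtain b where b: "b \<in> A" "inv g \<otimes> b \<in> C" by blast
  define X where "X = {a \<in> A. inv g \<otimes> a \<in> C}"
  note Bs = normal_in_subgroup[OF B(1)]
  have car: "a \<in> carrier G" if "a \<in> A" for a using that A_subset by blast
  have P2: "inv x \<otimes> y \<in> P 2" if "x \<in> A" "y \<in> A" for x y
  proof -
    have "inv x \<otimes> y \<in> P (Suc 0 + Suc 0)"
      using that inv_in_A by (intro P_mult) (simp_all only: P_one)
    then show ?thesis by (simp only: add_Suc add_0 numeral_2_eq_2)
  qed
  have XC: "inv b \<otimes> a \<in> C" if "a \<in> X" for a
  proof -
    have "inv (inv g \<otimes> b) \<otimes> (inv g \<otimes> a) \<in> C"
      using that b subgroup.m_closed[OF C] subgroup.m_inv_closed[OF C] by (auto simp: X_def)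
    then show ?thesis
      using that b g car by (auto simp: X_def group_word)
  qed
  obtain R where R: "R \<subseteq> S" "finite R" "real (card R) \<le> K ^ 15"
    "\<forall>x\<in>P (Suc 15) \<inter> S. \<exists>r\<in>R. x \<otimes> inv r \<in> P 2"
    using subgroup_cover[OF S, of 15] by (elim exE conjE) (rule that)
  define rel where "rel a r \<longleftrightarrow> commutator (inv b \<otimes> a) u \<otimes> inv r \<in> B" for a r
  have "\<exists>r\<in>R. rel a r" if a: "a \<in> X" for a
  proof -
    let ?k = "commutator (inv b \<otimes> a) u"
    have "inv b \<otimes> a \<in> P 2" using P2[OF b(1)] a by (simp add: X_def)
    then have "?k \<in> P (2 + 6 + 2 + 6)" using u(1) by (rule P_commutator)
    moreover have kS: "?k \<in> S" using u(3) XC[OF a] by blast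
    ultimately obtain r where r: "r \<in> R" "?k \<otimes> inv r \<in> P 2" using R(4) by auto
    then have "?k \<otimes> inv r \<in> S"
      using kS R(1) subgroup.m_closed[OF S] subgroup.m_inv_closed[OF S] by blast
    then show ?thesis using r B(2) unfolding rel_def by blast
  qed
  then obtain F where F: "F \<subseteq> X" "finite F" "card F \<le> card R"
    "\<forall>a\<in>X. \<exists>f\<in>F. \<exists>r\<in>R. rel a r \<and> rel f r"
    using finite_representatives[OF R(2), of X rel] by auto
  have "\<exists>f\<in>F. inv f \<otimes> a \<in> D" if "a \<in> A" "inv g \<otimes> a \<in> C" for a
  proof -
    have aX: "a \<in> X" using that by (simp add: X_def)
    then obtain f r where f: "f \<in> F" "r \<in> R" "rel a r" "rel f r" using F(4) by blast
    have fX: "f \<in> X" using f(1) F(1) by blast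
    define x where "x = inv b \<otimes> a"
    define y where "y = inv b \<otimes> f"
    have xy: "x \<in> C" "y \<in> C" using XC aX fX by (auto simp: x_def y_def)
    note cars = subgroup.mem_carrier[OF C xy(1)] subgroup.mem_carrier[OF C xy(2)]
      subgroup.mem_carrier[OF C u(2)]
    have r: "r \<in> carrier G" using f(2) R(1) subgroup.subset[OF S] by blast
    have fa: "inv f \<otimes> a = inv y \<otimes> x"
      unfolding x_def y_def using aX fX b car by (auto simp: X_def group_word)
    have "(commutator x u \<otimes> inv r) \<otimes> inv (commutator y u \<otimes> inv r) \<in> B"
      using f(3,4) subgroup.m_closed[OF Bs] subgroup.m_inv_closed[OF Bs]
      by (auto simp: rel_def x_def y_def)
    then have "commutator x u \<otimes> inv (commutator y u) \<in> B"
      using r commutator_closed[OF cars(1,3)] commutator_closed[OF cars(2,3)]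
      by (simp add: group_word)
    then have "inv y \<otimes> (commutator x u \<otimes> inv (commutator y u)) \<otimes> y \<in> B"
      using normal_in_conj_inv[OF B(1) C xy(2)] by blast
    \<comment> \<open>With x = b^-1 a and y = b^-1 f, equal cosets of [x,u] and [y,u] say that y^-1
      x = f^-1 a commutes with u modulo \<open>B\<close>.\<close>
    moreover have "commutator (inv y \<otimes> x) u = inv y \<otimes> (commutator x u \<otimes> inv (commutator y u)) \<otimes> y"
      using cars commutator_closed[OF cars(1,3)] commutator_closed[OF cars(2,3)]
      by (simp add: commutator_mult_left commutator_inv_left group_word)
    ultimately have "commutator (inv y \<otimes> x) u \<in> B" by simp
    moreover have "inv y \<otimes> x \<in> C"
      using xy subgroup.m_closed[OF C] subgroup.m_inv_closed[OF C] by blast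
    moreover have "inv y \<otimes> x \<in> P 2"
      using P2[of f a] fX that(1) fa by (simp add: X_def)
    ultimately have "inv f \<otimes> a \<in> D"
      unfolding fa by (intro D)
    then show ?thesis
      using f(1) by blast
  qed
  moreover have "F \<subseteq> carrier G" using F(1) car by (auto simp: X_def)
  moreover have "real (card F) \<le> K ^ 15" using F(3) R(3) by linarith
  ultimately show ?thesis
    unfolding coset_cover_def using F(2) by blast
qed

text \<open>Here q measures the room that Gleason's bound leaves for \<open>U\<close>. Going down,
  \<open>C\<close> shrinks and \<open>N\<close> grows by one u; coming back,
  \<open>central_by_bounded\<close> turns a subgroup bounded over the larger \<open>N\<close> into
  one bounded over \<open>N\<close>. The count s of rounds bounds both the step and the loss in
  cosets.\<close>

lemma nilpotent_mod_power:
  assumes "lower_central G n \<subseteq> N" "subgroup C G" "C = generate G ((P 2 \<inter> C) \<union> N)" "normal_in N C"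
    and "separated U" "U \<subseteq> P 6 \<inter> N" "K ^ 6 < real (card U) + real q"
  shows "\<exists>C' H s. subgroup C' G \<and> C' \<subseteq> C \<and> C' = generate G ((P 6 \<inter> C') \<union> N) \<and>
    normal_in H C' \<and> N \<subseteq> H \<and> real (card U + s) \<le> K ^ 6 \<and> H \<subseteq> P (power_bound K s) <#> N \<and>
    lower_central (G\<lparr>carrier := C'\<rparr>) s \<subseteq> H \<and>
    (\<forall>g\<in>carrier G. coset_cover g C C' (K ^ (15 * s)))"
  using assms
proof (induction q arbitrary: C N U)
  case 0
  then show ?case using card_separated_le[of U 6] by auto
next
  case (Suc q)
  note low = Suc.prems(1) and C = Suc.prems(2,3) and N = Suc.prems(4) and U = Suc.prems(5-7)
  note Ns = normal_in_subgroup[OF N]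
  have carN: "N \<subseteq> carrier G" and carC: "C \<subseteq> carrier G"
    using subgroup.subset[OF Ns] subgroup.subset[OF C(1)] by auto
  have NC: "N \<subseteq> C" using normal_in_subset[OF N] .
  note nil = upper_central_eq[OF C(1) N low]
  have P26: "P 2 \<subseteq> P 6" by (rule P_mono) simp
  show ?case
  proof (cases "P 6 \<inter> C \<subseteq> P 2 <#> N")
    \<comment> \<open>No further u exists. Taking S = C, the subgroup \<open>H\<close> contains the
      generators of \<open>C\<close>, so the quotient is trivial and s = 0.\<close>
    case True
    define H where "H = (P 2 \<inter> C) <#> N"
    have H: "normal_in H C"
      unfolding H_def by (rule normal_in_power_mult[OF C N normal_in_refl[OF C(1)] NC True])
    have PH: "P 2 \<inter> C \<subseteq> H"
      using set_multI[OF _ subgroup.one_closed[OF Ns], of _ "P 2 \<inter> C" G] carC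
      unfolding H_def by (auto simp: subset_iff)
    have NH: "N \<subseteq> H"
      using set_multI[of \<one> "P 2 \<inter> C" _ N G] one_in_P subgroup.one_closed[OF C(1)] carN
      unfolding H_def by (auto simp: subset_iff)
    have "generate G ((P 2 \<inter> C) \<union> N) \<subseteq> H"
      using PH NH normal_in_subgroup[OF H] by (intro generate_subgroup_incl) auto
    then have "C \<subseteq> H" using C(2) by simp
    moreover have "C = generate G ((P 6 \<inter> C) \<union> N)"
    proof
      have "generate G ((P 2 \<inter> C) \<union> N) \<subseteq> generate G ((P 6 \<inter> C) \<union> N)"
        using P26 by (intro mono_generate) blast
      then show "C \<subseteq> generate G ((P 6 \<inter> C) \<union> N)" using C(2) by simp
      show "generate G ((P 6 \<inter> C) \<union> N) \<subseteq> C"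
        using NC by (intro generate_subgroup_incl C) auto
    qed
    moreover have "H \<subseteq> P 2 <#> N"
      unfolding H_def by (intro mono_set_mult) auto
    moreover have "real (card U) \<le> K ^ 6"
      using U by (intro card_separated_le) auto
    ultimately show ?thesis
      using C(1) H NH by (intro exI[of _ C] exI[of _ H] exI[of _ 0]) (auto intro: coset_cover_refl)
  next
    case False
    have "P 6 \<inter> upper_central C N 0 \<subseteq> P 2 <#> N"
      using subset_P_mult_set[OF carN, of 2] by auto
    moreover have "\<not> P 6 \<inter> upper_central C N n \<subseteq> P 2 <#> N" using False nil by simp
    \<comment> \<open>Level k is small enough for \<open>normal_in_power_mult\<close>, while level
      \<open>Suc k\<close> provides u, central modulo level k.\<close>
    ultimately obtain k where k: "P 6 \<inter> upper_central C N k \<subseteq> P 2 <#> N"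
      "\<not> P 6 \<inter> upper_central C N (Suc k) \<subseteq> P 2 <#> N"
      using last_index_exists[of "\<lambda>k. P 6 \<inter> upper_central C N k \<subseteq> P 2 <#> N" n] by blast
    define S where "S = upper_central C N k"
    define B where "B = (P 2 \<inter> S) <#> N"
    have S: "normal_in S C" "N \<subseteq> S"
      unfolding S_def using upper_central_normal_in[OF C(1) N] subset_upper_central[OF C(1) N] by auto
    have B: "normal_in B C"
      unfolding B_def by (rule normal_in_power_mult[OF C N S k(1)[folded S_def]])
    note Ss = normal_in_subgroup[OF S(1)] and Bs = normal_in_subgroup[OF B]
    have PB: "P 2 \<inter> S \<subseteq> B"
      using set_multI[OF _ subgroup.one_closed[OF Ns], of _ "P 2 \<inter> S" G] subgroup.subset[OF Ss]
      unfolding B_def by (auto simp: subset_iff)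
    have NB: "N \<subseteq> B"
      using set_multI[of \<one> "P 2 \<inter> S" _ N G] one_in_P subgroup.one_closed[OF Ss] carN
      unfolding B_def by (auto simp: subset_iff)
    have B2: "B \<subseteq> P 2 <#> N"
      unfolding B_def by (intro mono_set_mult) auto
    have BC: "B \<subseteq> C" using normal_in_subset[OF B] .
    obtain u where u: "u \<in> P 6" "u \<in> center_mod C S" "u \<notin> P 2 <#> N"
      using k(2) by (auto simp: S_def)
    have uC: "u \<in> C" using u(2) by (simp add: center_mod_def)
    have u_car: "u \<in> carrier G" using uC carC by blast
    have uS: "commutator c u \<in> S" if "c \<in> C" for c
      using u(2) that carC u_car commutator_swap[OF Ss, of u c] by (auto simp: center_mod_def)
    define D where "D = {c \<in> C. commutator c u \<in> B}"
    define N1 where "N1 = generate G (insert u B)"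
    \<comment> \<open>Passing from \<open>D\<close> to this subgroup restores the generation
      hypothesis for the next round and keeps \<open>P 2 \<inter> D\<close>, on which the coset
      count depends.\<close>
    define C1 where "C1 = generate G ((P 2 \<inter> D) \<union> N1)"
    have Ds: "subgroup D G" unfolding D_def by (rule centralizer_subgroup[OF C(1) B uC])
    have DC: "D \<subseteq> C" by (auto simp: D_def)
    have "commutator u u = \<one>"
      using u_car by (simp add: commutator_def group_word)
    then have "u \<in> D" using uC subgroup.one_closed[OF Bs] by (simp add: D_def)
    moreover have BD: "B \<subseteq> D"
      using BC normal_in_commutator(1)[OF B C(1) _ uC] by (auto simp: D_def)
    ultimately have N1D: "N1 \<subseteq> D"
      unfolding N1_def by (intro generate_subgroup_incl Ds) auto
    have uB_car: "insert u B \<subseteq> carrier G" using u_car BC carC by blast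
    have N1s: "subgroup N1 G" unfolding N1_def by (rule generate_is_subgroup[OF uB_car])
    have BN1: "B \<subseteq> N1" and uN1: "u \<in> N1"
      unfolding N1_def by (auto intro: generate.incl)
    \<comment> \<open>For c in \<open>D\<close>, c u c^-1 = [c,u] u with [c,u] in
      \<open>B\<close>.\<close>
    have N1_D: "normal_in N1 D"
      unfolding normal_in_def
    proof (intro conjI N1s N1D ballI)
      fix c x assume c: "c \<in> D" and x: "x \<in> N1"
      have c_car: "c \<in> carrier G" using c DC carC by blast
      show "c \<otimes> x \<otimes> inv c \<in> N1"
      proof (rule conj_generate[OF N1s uB_car c_car _ x[unfolded N1_def]])
        fix y assume "y \<in> insert u B"
        then consider "y = u" | "y \<in> B" by blast
        then show "c \<otimes> y \<otimes> inv c \<in> N1"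
        proof cases
          case 1
          have "commutator c u \<in> N1" using c BN1 by (auto simp: D_def)
          then show ?thesis
            using 1 conj_eq_commutator_mult[OF c_car u_car] subgroup.m_closed[OF N1s _ uN1] by simp
        next
          case 2
          then show ?thesis using normal_in_conj[OF B] c DC BN1 by blast
        qed
      qed
    qed
    have D_car: "D \<subseteq> carrier G" using DC carC by blast
    have C1D: "C1 \<subseteq> D" unfolding C1_def using N1D by (intro generate_subgroup_incl Ds) auto
    have C1s: "subgroup C1 G"
      unfolding C1_def using D_car N1D by (intro generate_is_subgroup) auto
    have PC1: "P 2 \<inter> D \<subseteq> C1" and N1C1: "N1 \<subseteq> C1"
      unfolding C1_def by (auto intro: generate.incl)
    have C1_gen: "C1 = generate G ((P 2 \<inter> C1) \<union> N1)"
    proof -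
      have "P 2 \<inter> D = P 2 \<inter> C1" using PC1 C1D by blast
      then show ?thesis using C1_def by simp
    qed
    have N1_C1: "normal_in N1 C1" by (rule normal_in_mono[OF N1_D C1D N1C1])
    have cent: "commutator x c \<in> B" if x: "x \<in> N1" and c: "c \<in> D" for x c
    proof -
      have B_D: "normal_in B D" by (rule normal_in_mono[OF B DC BD])
      have "N1 \<subseteq> {x \<in> D. commutator x c \<in> B}"
        unfolding N1_def
      proof (rule generate_subgroup_incl[OF _ centralizer_subgroup[OF Ds B_D c]])
        have "commutator c u \<in> B" using c by (simp add: D_def)
        then have "commutator u c \<in> B"
          using c D_car u_car by (intro commutator_swap[OF Bs, of c u]) auto
        moreover have "commutator x c \<in> B" if "x \<in> B" for x
          using normal_in_commutator(1)[OF B C(1) that] c DC by blast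
        ultimately show "insert u B \<subseteq> {x \<in> D. commutator x c \<in> B}"
          using \<open>u \<in> D\<close> BD by auto
      qed
      then show ?thesis using x by blast
    qed
    have U_N: "U \<subseteq> N" using U(2) by blast
    note ins = separated_insert[OF U(1) Ns U_N u_car u(3)]
    have finU: "finite U" using U(2) finite_P finite_subset by blast
    have "\<exists>C' H s. subgroup C' G \<and> C' \<subseteq> C1 \<and> C' = generate G ((P 6 \<inter> C') \<union> N1) \<and>
      normal_in H C' \<and> N1 \<subseteq> H \<and> real (card (insert u U) + s) \<le> K ^ 6 \<and>
      H \<subseteq> P (power_bound K s) <#> N1 \<and> lower_central (G\<lparr>carrier := C'\<rparr>) s \<subseteq> H \<and>
      (\<forall>g\<in>carrier G. coset_cover g C1 C' (K ^ (15 * s)))"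
    proof (rule Suc.IH[OF _ C1s C1_gen N1_C1 ins(1)])
      show "lower_central G n \<subseteq> N1" using low NB BN1 by blast
      show "insert u U \<subseteq> P 6 \<inter> N1" using U(2) u(1) uN1 NB BN1 by blast
      show "K ^ 6 < real (card (insert u U)) + real q" using U(3) finU ins(2) by simp
    qed
    then obtain C' H1 s where C': "subgroup C' G" "C' \<subseteq> C1" "C' = generate G ((P 6 \<inter> C') \<union> N1)"
      and H1: "normal_in H1 C'" "N1 \<subseteq> H1" "H1 \<subseteq> P (power_bound K s) <#> N1"
        "lower_central (G\<lparr>carrier := C'\<rparr>) s \<subseteq> H1"
      and s: "real (card (insert u U) + s) \<le> K ^ 6"
      and cover: "\<forall>g\<in>carrier G. coset_cover g C1 C' (K ^ (15 * s))"
      by (elim exE conjE) (rule that)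
    have N1C': "N1 \<subseteq> C'" using H1(1,2) normal_in_subset by blast
    have C'D: "C' \<subseteq> D" using C'(2) C1D by blast
    \<comment> \<open>\<open>N1\<close> is generated by u in \<open>P 6\<close> and by
      \<open>B\<close>, a product of elements of \<open>P 2\<close> and \<open>N\<close>. Because of
      u, the conclusion has \<open>P 6\<close> where the hypothesis has \<open>P 2\<close>.\<close>
    have C'_gen: "C' = generate G ((P 6 \<inter> C') \<union> N)"
    proof
      show "generate G ((P 6 \<inter> C') \<union> N) \<subseteq> C'"
        using NB BN1 N1C' by (intro generate_subgroup_incl C') auto
      have gs: "subgroup (generate G ((P 6 \<inter> C') \<union> N)) G"
        using carN P_subset by (intro generate_is_subgroup) auto
      have "B \<subseteq> generate G ((P 6 \<inter> C') \<union> N)"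
      proof
        fix x assume "x \<in> B"
        then obtain a y where a: "a \<in> P 2 \<inter> S" "y \<in> N" "x = a \<otimes> y"
          unfolding B_def by (elim set_multE)
        then have "a \<in> P 6 \<inter> C'" using PB P26 BN1 N1C' by blast
        then have "a \<in> generate G ((P 6 \<inter> C') \<union> N)" by (intro generate.incl) blast
        moreover have "y \<in> generate G ((P 6 \<inter> C') \<union> N)" using a(2) by (intro generate.incl) blast
        ultimately show "x \<in> generate G ((P 6 \<inter> C') \<union> N)"
          unfolding a(3) by (rule generate.eng)
      qed
      moreover have "u \<in> generate G ((P 6 \<inter> C') \<union> N)"
        using u(1) uN1 N1C' by (intro generate.incl) blast
      ultimately have "N1 \<subseteq> generate G ((P 6 \<inter> C') \<union> N)"
        unfolding N1_def by (intro generate_subgroup_incl gs) auto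
      moreover have "P 6 \<inter> C' \<subseteq> generate G ((P 6 \<inter> C') \<union> N)"
        by (auto intro: generate.incl)
      ultimately have "generate G ((P 6 \<inter> C') \<union> N1) \<subseteq> generate G ((P 6 \<inter> C') \<union> N)"
        by (intro generate_subgroup_incl gs) auto
      then show "C' \<subseteq> generate G ((P 6 \<inter> C') \<union> N)" using C'(3) by simp
    qed
    have N_C': "normal_in N C'" and B_C': "normal_in B C'"
      using N B NB BN1 N1C' C'D DC by (blast intro: normal_in_mono)+
    define r where "r = 2 * power_bound K s + 14"
    \<comment> \<open>\<open>N1\<close> is central modulo \<open>B\<close> and \<open>H1\<close> is
      bounded over \<open>N1\<close>. The bounded part moves below the central factor: [H1,C'] lies
      in some \<open>H\<close> bounded over \<open>B\<close>, which accounts for one more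
      step.\<close>
    have "\<exists>H. normal_in H C' \<and> B \<subseteq> H \<and> H \<subseteq> P (r * nat \<lceil>K ^ r + 1\<rceil> + 2) <#> B \<and>
        (\<forall>x\<in>H1. \<forall>c\<in>C'. commutator x c \<in> H)"
      unfolding r_def
    proof (rule central_by_bounded[OF C'(1) C'_gen N_C' upper_central_eq[OF C'(1) N_C' low]
          H1(1,2) N1s H1(3) B_C' NB])
      show "B \<subseteq> H1" using BN1 H1(2) by blast
      show "commutator x c \<in> B" if "x \<in> N1" "c \<in> C'" for x c using cent that C'D by blast
    qed
    then obtain H where H: "normal_in H C'" "B \<subseteq> H" "H \<subseteq> P (r * nat \<lceil>K ^ r + 1\<rceil> + 2) <#> B"
      "\<forall>x\<in>H1. \<forall>c\<in>C'. commutator x c \<in> H"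
      by auto
    have "H \<subseteq> P (r * nat \<lceil>K ^ r + 1\<rceil> + 2 + 2) <#> N"
      using H(3) B2 carN by (rule set_power_mult_assoc)
    also have "r * nat \<lceil>K ^ r + 1\<rceil> + 2 + 2 = power_bound K (Suc s)"
      by (simp add: Let_def r_def)
    finally have "H \<subseteq> P (power_bound K (Suc s)) <#> N" .
    moreover have "lower_central (G\<lparr>carrier := C'\<rparr>) (Suc s) \<subseteq> H"
      using H(4) by (intro lower_central_subset_Suc[OF C'(1) normal_in_subgroup[OF H(1)] H1(4)]) blast
    moreover have "coset_cover g C C' (K ^ (15 * Suc s))" if "g \<in> carrier G" for g
    proof -
      have "coset_cover g C C1 (K ^ 15)"
        using uS PC1 by (intro coset_cover_centralizer[OF C(1) Ss B PB u(1) uC _ _ that]) (auto simp: D_def)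
      then have "coset_cover g C C' (K ^ 15 * K ^ (15 * s))"
        using cover K_ge_1 by (intro coset_cover_trans[of g C C1]) auto
      then show ?thesis by (simp add: power_add)
    qed
    moreover have "real (card U + Suc s) \<le> K ^ 6" using s finU ins(2) by simp
    moreover have "C' \<subseteq> C" using C'D DC by blast
    moreover have "N \<subseteq> H" using NB H(2) by blast
    ultimately show ?thesis
      using C'(1) C'_gen H(1) by blast
  qed
qed

end

section \<open>Residually nilpotent groups\<close>

lemma (in group) lower_central_normal_in: "normal_in (lower_central G n) (carrier G)"
proof (induction n)
  case 0
  then show ?case by (simp add: normal_in_refl subgroup_self)
next
  case (Suc n)
  let ?S = "{x \<otimes> y \<otimes> inv x \<otimes> inv y | x y. x \<in> lower_central G n \<and> y \<in> carrier G}"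
  have S_eq: "?S = {commutator x y | x y. x \<in> lower_central G n \<and> y \<in> carrier G}"
    by (simp add: commutator_def)
  have S_car: "?S \<subseteq> carrier G"
    using lower_central_carrier[of n] by (auto simp: subset_iff)
  have sub: "subgroup (generate G ?S) G"
    by (rule generate_is_subgroup[OF S_car])
  have "d \<otimes> x \<otimes> inv d \<in> generate G ?S" if d: "d \<in> carrier G" and x: "x \<in> generate G ?S" for d x
  proof (rule conj_generate[OF sub S_car d _ x])
    fix z assume "z \<in> ?S"
    then obtain x y where xy: "x \<in> lower_central G n" "y \<in> carrier G" "z = commutator x y"
      unfolding S_eq by blast
    have x_car: "x \<in> carrier G" using xy(1) lower_central_carrier by blast
    have "d \<otimes> z \<otimes> inv d = commutator (d \<otimes> x \<otimes> inv d) (d \<otimes> y \<otimes> inv d)"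
      unfolding xy(3) using d xy(2) x_car by (simp add: commutator_def group_word)
    moreover have "d \<otimes> x \<otimes> inv d \<in> lower_central G n"
      using normal_in_conj[OF Suc d xy(1)] .
    moreover have "d \<otimes> y \<otimes> inv d \<in> carrier G" using d xy(2) by simp
    ultimately show "d \<otimes> z \<otimes> inv d \<in> generate G ?S"
      unfolding S_eq by (intro generate.incl) blast
  qed
  then show ?case
    unfolding normal_in_def lower_central.simps using sub subgroup.subset[OF sub] by blast
qed

lemma (in group_hom) lower_central_image_surj:
  assumes "h ` carrier G = carrier H"
  shows "lower_central H n = h ` lower_central G n"
proof (induction n)
  case 0
  then show ?case using assms by simp
next
  case (Suc n)
  let ?S = "{x \<otimes> y \<otimes> inv x \<otimes> inv y | x y. x \<in> lower_central G n \<and> y \<in> carrier G}"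
  have car: "x \<in> carrier G" if "x \<in> lower_central G n" for x
    using that G.lower_central_carrier by blast
  have S: "?S \<subseteq> carrier G"
    using car by auto
  have "{x \<otimes>\<^bsub>H\<^esub> y \<otimes>\<^bsub>H\<^esub> inv\<^bsub>H\<^esub> x \<otimes>\<^bsub>H\<^esub> inv\<^bsub>H\<^esub> y | x y. x \<in> lower_central H n \<and> y \<in> carrier H}
      \<subseteq> h ` ?S"
  proof clarify
    fix x y assume "x \<in> lower_central H n" "y \<in> carrier H"
    then obtain a b where ab: "a \<in> lower_central G n" "b \<in> carrier G" "x = h a" "y = h b"
      unfolding Suc assms[symmetric] by blast
    then show "x \<otimes>\<^bsub>H\<^esub> y \<otimes>\<^bsub>H\<^esub> inv\<^bsub>H\<^esub> x \<otimes>\<^bsub>H\<^esub> inv\<^bsub>H\<^esub> y \<in> h ` ?S"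
      using car by (intro image_eqI[of _ _ "a \<otimes> b \<otimes> inv a \<otimes> inv b"]) auto
  qed
  then have "lower_central H (Suc n) \<subseteq> h ` lower_central G (Suc n)"
    unfolding lower_central.simps generate_img[OF S, symmetric] by (rule H.mono_generate)
  then show ?case using lower_central_image[of "Suc n"] by blast
qed

text \<open>The quotient map carries the lower central series onto that of the quotient, so
  nilpotency can be tested inside \<open>G\<close>.\<close>

lemma (in normal) nilpotent_FactGroup_iff:
  "nilpotent_of_step_at_most (G Mod H) s \<longleftrightarrow> lower_central G s \<subseteq> H"
proof -
  interpret Q: group "G Mod H" by (rule factorgroup_is_group)
  interpret q: group_hom G "G Mod H" "\<lambda>a. H #> a"
    using r_coset_hom_Mod by unfold_locales
  have "lower_central (G Mod H) s = (\<lambda>a. H #> a) ` lower_central G s"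
    by (rule q.lower_central_image_surj) (auto simp: FactGroup_def RCOSETS_def)
  moreover have "H #> a = H \<longleftrightarrow> a \<in> H" if "a \<in> lower_central G s" for a
    using that lower_central_carrier[of s] rcos_self[of a H] coset_join2[of a H] subgroup_axioms by blast
  ultimately have "lower_central (G Mod H) s \<subseteq> {H} \<longleftrightarrow> lower_central G s \<subseteq> H"
    by auto
  then show ?thesis
    using Q.one_in_lower_central[of s] Q.is_group by (auto simp: nilpotent_of_step_at_most_def)
qed

lemma (in group) normal_in_iff_normal:
  assumes "subgroup C G"
  shows "normal_in H C \<longleftrightarrow> H \<lhd> G\<lparr>carrier := C\<rparr>"
proof -
  interpret C: group "G\<lparr>carrier := C\<rparr>" by (rule subgroup_imp_group[OF assms])
  have "subgroup H (G\<lparr>carrier := C\<rparr>) \<longleftrightarrow> subgroup H G \<and> H \<subseteq> C"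
    using incl_subgroup[OF assms] subgroup_incl[OF _ assms] subgroup.subset by fastforce
  then show ?thesis
    by (auto simp: normal_in_def C.normal_inv_iff m_inv_consistent[OF assms])
qed

lemma (in group) covered_by_left_cosetsI:
  assumes "F \<subseteq> carrier G" "finite F" "real (card F) \<le> r" "A \<subseteq> carrier G"
    and "\<And>a. a \<in> A \<Longrightarrow> \<exists>f\<in>F. inv f \<otimes> a \<in> C"
  shows "covered_by_left_cosets G A C r"
proof -
  have "real (card ((\<lambda>f. f <# C) ` F)) \<le> r"
    using card_image_le[OF assms(2), of "\<lambda>f. f <# C"] assms(3) by linarith
  moreover have "A \<subseteq> \<Union> ((\<lambda>f. f <# C) ` F)"
  proof
    fix a assume a: "a \<in> A"
    then obtain f where f: "f \<in> F" "inv f \<otimes> a \<in> C" using assms(5) by blast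
    have "f \<in> carrier G" "a \<in> carrier G" using a f assms(1,4) by auto
    then have "a = f \<otimes> (inv f \<otimes> a)"
      by (simp add: mult_inv_cancel)
    then show "a \<in> \<Union> ((\<lambda>f. f <# C) ` F)"
      using f by (auto simp: l_coset_def)
  qed
  moreover have "(\<lambda>f. f <# C) ` F \<subseteq> lcosets C"
    using assms(1) by (auto simp: LCOSETS_def)
  ultimately show ?thesis
    unfolding covered_by_left_cosets_def using assms(2) by blast
qed

section \<open>From all nilpotent quotients to the group itself\<close>

lemma residually_nilpotent_lower_central:
  assumes "group G" "residually_nilpotent G" "g \<in> carrier G" "g \<noteq> \<one>\<^bsub>G\<^esub>"
  shows "\<exists>s. \<forall>n\<ge>s. g \<notin> lower_central G n"
proof -
  obtain N :: "'a set monoid" and \<pi> where N: "nilpotent_group N" "\<pi> \<in> hom G N" "\<pi> g \<noteq> \<one>\<^bsub>N\<^esub>"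
    using assms unfolding residually_nilpotent_def by blast
  then obtain s where s: "group N" "lower_central N s = {\<one>\<^bsub>N\<^esub>}"
    by (auto simp: nilpotent_group_def nilpotent_of_step_at_most_def)
  interpret N: group N by fact
  interpret \<pi>: group_hom G N \<pi>
    using assms(1) s(1) N(2) by (simp add: group_hom_def group_hom_axioms_def)
  \<comment> \<open>Exclusion from all late terms is wanted, because pigeonhole later yields only an
    infinite set of indices.\<close>
  have "lower_central N (s + k) = {\<one>\<^bsub>N\<^esub>}" for k
  proof (induction k)
    case (Suc k)
    have "lower_central N (Suc (s + k)) \<subseteq> {\<one>\<^bsub>N\<^esub>}"
      unfolding lower_central.simps Suc
      by (intro N.generate_subgroup_incl N.triv_subgroup) auto
    then show ?case using N.one_in_lower_central[of "Suc (s + k)"] by auto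
  qed (simp add: s)
  then have "g \<notin> lower_central G n" if "s \<le> n" for n
    using \<pi>.lower_central_image[of n] N(3) that by (metis image_subset_iff le_add_diff_inverse singletonD)
  then show ?thesis by blast
qed

text \<open>The exponent may depend on \<open>K\<close> but not on the step; the sum dominates the
  bound for every admissible s.\<close>

definition total_power_bound :: "real \<Rightarrow> nat" where
  "total_power_bound K = (\<Sum>s\<le>nat \<lfloor>K ^ 6\<rfloor>. power_bound K s)"

context approximate_group
begin

text \<open>\<open>nilpotent_mod_power\<close> is started with the group generated by A^2 and the
  lower central term. None of the bounds depends on \<open>n\<close>.\<close>

lemma nilpotent_mod_lower_central:
  "\<exists>C H s. subgroup C G \<and> normal_in H C \<and> s \<le> nat \<lfloor>K ^ 6\<rfloor> \<and>
    H \<subseteq> P (total_power_bound K) <#> lower_central G n \<and>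
    lower_central (G\<lparr>carrier := C\<rparr>) s \<subseteq> H \<and>
    coset_cover \<one> (carrier G) C (K ^ (15 * nat \<lfloor>K ^ 6\<rfloor>))"
proof -
  let ?N = "lower_central G n"
  note N = lower_central_normal_in[of n]
  define C0 where "C0 = generate G (P 2 \<union> ?N)"
  have gen: "P 2 \<union> ?N \<subseteq> carrier G"
    using P_subset lower_central_carrier by blast
  have C0: "subgroup C0 G" unfolding C0_def by (rule generate_is_subgroup[OF gen])
  have PC0: "P 2 \<subseteq> C0" and NC0: "?N \<subseteq> C0" unfolding C0_def by (auto intro: generate.incl)
  have "P 2 \<inter> C0 = P 2" using PC0 by blast
  then have C0_gen: "C0 = generate G ((P 2 \<inter> C0) \<union> ?N)" by (simp add: C0_def)
  have "K ^ 6 < real (card {}) + real (Suc (nat \<lceil>K ^ 6\<rceil>))"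
    using le_less_trans[OF real_nat_ceiling_ge[of "K ^ 6"] less_add_one] by simp
  then obtain C H s where C: "subgroup C G" and H: "normal_in H C"
    and s: "real (card {} + s) \<le> K ^ 6" and HP: "H \<subseteq> P (power_bound K s) <#> ?N"
    and low: "lower_central (G\<lparr>carrier := C\<rparr>) s \<subseteq> H"
    and cover: "\<forall>g\<in>carrier G. coset_cover g C0 C (K ^ (15 * s))"
    using nilpotent_mod_power[OF order_refl C0 C0_gen normal_in_mono[OF N subgroup.subset[OF C0] NC0],
        of "{}" "Suc (nat \<lceil>K ^ 6\<rceil>)"] by (auto simp: separated_def)
  have s': "s \<le> nat \<lfloor>K ^ 6\<rfloor>" using s by (simp add: le_nat_floor)
  have "power_bound K s \<le> total_power_bound K"
    unfolding total_power_bound_def using s' by (intro member_le_sum) auto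
  then have "H \<subseteq> P (total_power_bound K) <#> ?N"
    using HP P_mult_set_mono by blast
  \<comment> \<open>All of \<open>A\<close> lies in \<open>C0\<close>, so a cover of its part in
    \<open>C0\<close> covers \<open>A\<close>.\<close>
  moreover have "coset_cover \<one> (carrier G) C (K ^ (15 * nat \<lfloor>K ^ 6\<rfloor>))"
  proof -
    obtain F where F: "F \<subseteq> carrier G" "finite F" "real (card F) \<le> K ^ (15 * s)"
      "\<forall>a\<in>A. inv \<one> \<otimes> a \<in> C0 \<longrightarrow> (\<exists>f\<in>F. inv f \<otimes> a \<in> C)"
      using bspec[OF cover one_closed] unfolding coset_cover_def by (elim exE conjE) (rule that)
    have "K ^ (15 * s) \<le> K ^ (15 * nat \<lfloor>K ^ 6\<rfloor>)"
      using s' K_ge_1 by (intro power_increasing) auto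
    moreover have "inv \<one> \<otimes> a \<in> C0" if "a \<in> A" for a
    proof -
      have "a \<in> C0" using P_mono[of "Suc 0" 2] PC0 that by (auto simp: P_one)
      then show ?thesis using subgroup.mem_carrier[OF C0] by simp
    qed
    ultimately show ?thesis
      unfolding coset_cover_def using F by (intro exI[of _ F]) auto
  qed
  ultimately show ?thesis
    using C H s' low by blast
qed

text \<open>\<open>C\<close> and \<open>H\<close> are intersections of the subgroups found modulo infinitely many terms of the lower
  central series, chosen such that \<open>C n \<inter> P 2\<close> and the step do not depend on \<open>n\<close>.\<close>

lemma residually_nilpotent_cover:
  assumes res: "\<And>g. g \<in> carrier G \<Longrightarrow> g \<noteq> \<one> \<Longrightarrow> \<exists>s. \<forall>n\<ge>s. g \<notin> lower_central G n"
  shows "\<exists>C H s. subgroup C G \<and> normal_in H C \<and> s \<le> nat \<lfloor>K ^ 6\<rfloor> \<and>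
    H \<subseteq> P (total_power_bound K) \<and> lower_central (G\<lparr>carrier := C\<rparr>) s \<subseteq> H \<and>
    covered_by_left_cosets G A C (K ^ (15 * nat \<lfloor>K ^ 6\<rfloor>))"
proof -
  define t where "t = nat \<lfloor>K ^ 6\<rfloor>"
  define M where "M = total_power_bound K"
  have "\<forall>n. \<exists>C H s. subgroup C G \<and> normal_in H C \<and> s \<le> t \<and> H \<subseteq> P M <#> lower_central G n \<and>
    lower_central (G\<lparr>carrier := C\<rparr>) s \<subseteq> H \<and> coset_cover \<one> (carrier G) C (K ^ (15 * t))"
    unfolding t_def M_def using nilpotent_mod_lower_central by blast
  then obtain C H s where C: "\<And>n. subgroup (C n) G" and H: "\<And>n. normal_in (H n) (C n)"
    and s: "\<And>n. s n \<le> t" and HP: "\<And>n. H n \<subseteq> P M <#> lower_central G n"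
    and low: "\<And>n. lower_central (G\<lparr>carrier := C n\<rparr>) (s n) \<subseteq> H n"
    and cover: "\<And>n. coset_cover \<one> (carrier G) (C n) (K ^ (15 * t))"
    by metis
  define f where "f n = (C n \<inter> P 2, s n)" for n
  have "range f \<subseteq> Pow (P 2) \<times> {..t}" using s by (auto simp: f_def)
  then have "finite (range f)" by (rule finite_subset) (simp add: finite_P)
  then obtain n0 where n0: "infinite {n. f n = f n0}"
    using pigeonhole_infinite[of UNIV f] by auto
  define I where "I = {n. f n = f n0}"
  have I: "infinite I" "I \<noteq> {}" using n0 by (auto simp: I_def)
  have CI: "C n \<inter> P 2 = C n0 \<inter> P 2" and sI: "s n = s n0" if "n \<in> I" for n
    using that by (auto simp: I_def f_def)
  define C' where "C' = (\<Inter>n\<in>I. C n)"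
  define H' where "H' = (\<Inter>n\<in>I. H n)"
  have C's: "subgroup C' G" unfolding C'_def using C I by (intro subgroups_Inter) auto
  have H's: "subgroup H' G"
    unfolding H'_def using normal_in_subgroup[OF H] I by (intro subgroups_Inter) auto
  have "normal_in H' C'"
    unfolding normal_in_def
  proof (intro conjI H's ballI)
    show "H' \<subseteq> C'" unfolding H'_def C'_def using normal_in_subset[OF H] by blast
    show "c \<otimes> x \<otimes> inv c \<in> H'" if "c \<in> C'" "x \<in> H'" for c x
      using that normal_in_conj[OF H] unfolding H'_def C'_def by blast
  qed
  moreover have "H' \<subseteq> P M"
  proof
    fix x assume x: "x \<in> H'"
    then have x_car: "x \<in> carrier G" using subgroup.subset[OF H's] by blast
    have "\<exists>e. e \<in> P M \<and> inv e \<otimes> x \<in> lower_central G n" if "n \<in> I" for n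
    proof -
      have "x \<in> P M <#> lower_central G n" using x that HP by (auto simp: H'_def)
      then obtain e y where e: "e \<in> P M" "y \<in> lower_central G n" "x = e \<otimes> y"
        by (elim set_multE)
      then have "inv e \<otimes> x = y"
        using P_carrier[of e M] lower_central_carrier[of n] by (auto simp: inv_mult_cancel)
      then show ?thesis using e by blast
    qed
    then obtain e where e: "\<And>n. n \<in> I \<Longrightarrow> e n \<in> P M \<and> inv (e n) \<otimes> x \<in> lower_central G n"
      by metis
    have "finite (e ` I)" by (rule finite_subset[OF _ finite_P[of M]]) (use e in auto)
    \<comment> \<open>One value e serves infinitely many n, so e^-1 x lies in arbitrarily late lower
      central terms and is trivial by \<open>res\<close>.\<close>
    then obtain n1 where n1: "n1 \<in> I" "infinite {n \<in> I. e n = e n1}"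
      using pigeonhole_infinite[OF I(1), of e] by auto
    have e_car: "e n1 \<in> carrier G" using e[OF n1(1)] P_carrier by blast
    have "inv (e n1) \<otimes> x = \<one>"
    proof (rule ccontr)
      assume "inv (e n1) \<otimes> x \<noteq> \<one>"
      then obtain k where k: "\<forall>n\<ge>k. inv (e n1) \<otimes> x \<notin> lower_central G n"
        using res[of "inv (e n1) \<otimes> x"] e_car x_car by auto
      obtain n where "n \<ge> k" "n \<in> {n \<in> I. e n = e n1}"
        using n1(2) by (meson infinite_nat_iff_unbounded_le)
      then show False using k e[of n] by auto
    qed
    then have "x = e n1"
      using e_car x_car mult_inv_cancel[of "e n1" x] by simp
    then show "x \<in> P M" using e[OF n1(1)] by simp
  qed
  moreover have "lower_central (G\<lparr>carrier := C'\<rparr>) (s n0) \<subseteq> H'"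
    unfolding H'_def
  proof (rule INT_greatest)
    fix n assume n: "n \<in> I"
    have "C' \<subseteq> C n" using n by (auto simp: C'_def)
    then show "lower_central (G\<lparr>carrier := C'\<rparr>) (s n0) \<subseteq> H n"
      using lower_central_mono[OF C's C[of n], of "s n0"] low[of n] sI[OF n] by auto
  qed
  moreover have "covered_by_left_cosets G A C' (K ^ (15 * t))"
  proof -
    obtain F where F: "F \<subseteq> carrier G" "finite F" "real (card F) \<le> K ^ (15 * t)"
      "\<forall>a\<in>A. inv \<one> \<otimes> a \<in> carrier G \<longrightarrow> (\<exists>f\<in>F. inv f \<otimes> a \<in> C n0)"
      using cover[of n0] unfolding coset_cover_def by blast
    then have "\<exists>f\<in>F. inv f \<otimes> a \<in> C n0" if "a \<in> A" for a using that A_subset by auto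
    \<comment> \<open>With centres in \<open>A\<close>, the quotients f'^-1 a lie in
      \<open>P 2\<close>, where all \<open>C n\<close> with n in \<open>I\<close> agree; so a cover
      by cosets of \<open>C n0\<close> is one by cosets of \<open>C'\<close>.\<close>
    then obtain F' where F': "F' \<subseteq> A" "finite F'" "card F' \<le> card F"
      "\<forall>a\<in>A. \<exists>f'\<in>F'. \<exists>f\<in>F. inv f \<otimes> a \<in> C n0 \<and> inv f \<otimes> f' \<in> C n0"
      using finite_representatives[OF F(2), of A "\<lambda>a f. inv f \<otimes> a \<in> C n0"] by auto
    show ?thesis
    proof (rule covered_by_left_cosetsI[OF _ F'(2) _ A_subset])
      show "F' \<subseteq> carrier G" using F'(1) A_subset by blast
      show "real (card F') \<le> K ^ (15 * t)" using F(3) F'(3) by linarith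
      fix a assume a: "a \<in> A"
      then obtain f' f where f: "f' \<in> F'" "f \<in> F" "inv f \<otimes> a \<in> C n0" "inv f \<otimes> f' \<in> C n0"
        using F'(4) by blast
      have cars: "f' \<in> carrier G" "f \<in> carrier G" "a \<in> carrier G" "f' \<in> A"
        using f F F' A_subset a by auto
      have "inv (inv f \<otimes> f') \<otimes> (inv f \<otimes> a) \<in> C n0"
        using f(3,4) subgroup.m_closed[OF C] subgroup.m_inv_closed[OF C] by blast
      then have "inv f' \<otimes> a \<in> C n0" using cars by (simp add: group_word)
      moreover have "inv f' \<otimes> a \<in> P (Suc 0 + Suc 0)"
        using a cars(4) inv_in_A by (intro P_mult) (simp_all only: P_one)
      then have "inv f' \<otimes> a \<in> P 2"
        by (simp only: add_Suc add_0 numeral_2_eq_2)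
      ultimately have "inv f' \<otimes> a \<in> C'" using CI by (auto simp: C'_def)
      then show "\<exists>f\<in>F'. inv f \<otimes> a \<in> C'" using f(1) by blast
    qed
  qed
  ultimately show ?thesis
    using C's s[of n0] unfolding t_def M_def by blast
qed

end

section \<open>The explicit constants\<close>

lemma power_le_exp_powr:
  fixes K :: real
  assumes "1 \<le> K"
  shows "K ^ (15 * nat \<lfloor>K ^ 6\<rfloor>) \<le> exp (K powr 22)"
proof -
  have "K > 0" using assms by simp
  \<comment> \<open>Together with the exponent bound K^6 this gives K^22, whence the constant
    22.\<close>
  have "15 * ln K \<le> K ^ 16"
  proof -
    have "1 + 16 * ln K \<le> exp (16 * ln K)" by (rule exp_ge_add_one_self)
    also have "exp (16 * ln K) = K powr 16" using \<open>K > 0\<close> by (simp add: powr_def)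
    also have "\<dots> = K ^ 16" using \<open>K > 0\<close> powr_realpow[of K 16] by simp
    finally show ?thesis using assms ln_ge_zero[of K] by linarith
  qed
  moreover have "real (nat \<lfloor>K ^ 6\<rfloor>) \<le> K ^ 6"
    using assms by (simp add: of_nat_nat)
  ultimately have "real (nat \<lfloor>K ^ 6\<rfloor>) * (15 * ln K) \<le> K ^ 6 * K ^ 16"
    using assms by (intro mult_mono) auto
  also have "\<dots> = K powr 22"
    using \<open>K > 0\<close> powr_realpow[of K 22] by (simp flip: power_add)
  finally have "real (15 * nat \<lfloor>K ^ 6\<rfloor>) * ln K \<le> K powr 22" by (simp add: mult_ac)
  moreover have "K ^ (15 * nat \<lfloor>K ^ 6\<rfloor>) = exp (real (15 * nat \<lfloor>K ^ 6\<rfloor>) * ln K)"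
    using \<open>K > 0\<close> powr_realpow[of K "15 * nat \<lfloor>K ^ 6\<rfloor>"] by (simp add: powr_def)
  ultimately show ?thesis by simp
qed

text \<open>\<open>Suc\<close> makes the positivity of m immediate.\<close>

lemma uniform_bounds_total_power_bound:
  "uniform_bounds TYPE('a) 22 (\<lambda>K. Suc (total_power_bound K))"
  unfolding uniform_bounds_def
proof (intro allI impI)
  fix G :: "'a monoid" and K :: real and A
  assume G: "group G" "residually_nilpotent G" and K: "1 \<le> K" "approximate_subgroup G K A"
  interpret approximate_group G A K
    using G K by (simp add: approximate_group_def approximate_group_axioms_def)
  obtain C H s where C: "subgroup C G" "normal_in H C" "s \<le> nat \<lfloor>K ^ 6\<rfloor>"
    "H \<subseteq> P (total_power_bound K)" "lower_central (G\<lparr>carrier := C\<rparr>) s \<subseteq> H"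
    "covered_by_left_cosets G A C (K ^ (15 * nat \<lfloor>K ^ 6\<rfloor>))"
    using residually_nilpotent_cover[OF residually_nilpotent_lower_central[OF G]] by blast
  have n: "H \<lhd> G\<lparr>carrier := C\<rparr>" using C by (simp add: normal_in_iff_normal)
  have "nilpotent_of_step_at_most (G\<lparr>carrier := C\<rparr> Mod H) s"
    using C(5) by (simp add: normal.nilpotent_FactGroup_iff[OF n])
  moreover have "real s \<le> K ^ 6"
  proof -
    have "real s \<le> real (nat \<lfloor>K ^ 6\<rfloor>)" using C(3) by (rule of_nat_mono)
    also have "\<dots> \<le> K ^ 6" using K by (intro of_nat_floor) simp
    finally show ?thesis .
  qed
  moreover have "covered_by_left_cosets G A C (exp (K powr 22))"
    using C(6) power_le_exp_powr[OF K(1)] unfolding covered_by_left_cosets_def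
    by (meson order_trans)
  moreover have "H \<subseteq> P (Suc (total_power_bound K))"
    using C(4) P_mono[of "total_power_bound K" "Suc (total_power_bound K)"] by auto
  ultimately show "\<exists>H C. subgroup C G \<and> H \<lhd> G\<lparr>carrier := C\<rparr> \<and>
           H \<subseteq> set_power G A (Suc (total_power_bound K)) \<and>
           (\<exists>s::nat. real s \<le> K ^ 6 \<and> nilpotent_of_step_at_most (G\<lparr>carrier := C\<rparr> Mod H) s) \<and>
           covered_by_left_cosets G A C (exp (K powr 22))"
    using C(1) n by blast
qed

section \<open>Reduction to countable groups\<close>

lemma (in group_hom) set_power_image:
  "A \<subseteq> carrier G \<Longrightarrow> h ` set_power G A n = set_power H (h ` A) n"
proof (induction n)
  case (Suc n)
  have "set_power G A n \<subseteq> carrier G"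
    using Suc.prems by (induction n) (auto simp: set_mult_def)
  then have "h ` (A <#> set_power G A n) = h ` A <#>\<^bsub>H\<^esub> h ` set_power G A n"
    using Suc.prems by (auto simp: set_mult_def image_UN subset_iff)
  then show ?case using Suc by simp
qed simp

locale group_embedding = group_hom G H h
  for G :: "('a, 'b) monoid_scheme" (structure) and H :: "('c, 'd) monoid_scheme" (structure) and h +
  assumes inj: "inj_on h (carrier G)"
begin

text \<open>If h z = x a with a in the image, then x is in the image too. So the preimage of
  \<open>X\<close> covers, and injectivity keeps it no larger than \<open>X\<close>.\<close>

lemma approximate_subgroup_vimage:
  assumes A: "approximate_subgroup H K A" and sub: "A \<subseteq> h ` carrier G"
  defines "A' \<equiv> {x \<in> carrier G. h x \<in> A}"
  shows "approximate_subgroup G K A'"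
proof -
  have A_car: "A \<subseteq> carrier H" and A_inv: "set_inv\<^bsub>H\<^esub> A = A" and fin: "finite A"
    and one: "\<one>\<^bsub>H\<^esub> \<in> A"
    using A by (auto simp: approximate_subgroup_def)
  obtain X where X: "X \<subseteq> carrier H" "finite X" "real (card X) \<le> K" "set_power H A 2 \<subseteq> X <#>\<^bsub>H\<^esub> A"
    using A by (auto simp: approximate_subgroup_def)
  have A'_car: "A' \<subseteq> carrier G" by (auto simp: A'_def)
  have hA': "h ` A' = A" using sub by (auto simp: A'_def)
  have finA': "finite A'"
    by (rule finite_imageD[of h]) (use fin hA' inj A'_car in \<open>auto intro: inj_on_subset\<close>)
  have inv_A: "inv\<^bsub>H\<^esub> a \<in> A" if "a \<in> A" for a
  proof -
    have "inv\<^bsub>H\<^esub> a \<in> set_inv\<^bsub>H\<^esub> A" using that by (auto simp: SET_INV_def)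
    then show ?thesis by (simp add: A_inv)
  qed
  have A'_inv: "inv a \<in> A'" if "a \<in> A'" for a
    using that inv_A by (auto simp: A'_def)
  have "set_inv A' = A'"
  proof
    show "set_inv A' \<subseteq> A'" using A'_inv by (auto simp: SET_INV_def)
    show "A' \<subseteq> set_inv A'"
    proof
      fix a assume a: "a \<in> A'"
      then have "a = inv (inv a)" using A'_car by auto
      then show "a \<in> set_inv A'" using A'_inv[OF a] unfolding SET_INV_def by blast
    qed
  qed
  define X' where "X' = {x \<in> carrier G. h x \<in> X}"
  have injX': "inj_on h X'" using inj by (rule inj_on_subset) (auto simp: X'_def)
  have hX': "h ` X' \<subseteq> X" by (auto simp: X'_def)
  have finX': "finite X'" using inj_on_finite[OF injX' hX' X(2)] .
  have "card X' \<le> card X" using card_inj_on_le[OF injX' hX' X(2)] .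
  moreover have "set_power G A' 2 \<subseteq> X' <#> A'"
  proof
    fix z assume z: "z \<in> set_power G A' 2"
    have "set_power G A' 2 \<subseteq> carrier G"
      using A'_car by (auto simp: set_mult_def numeral_2_eq_2)
    then have z_car: "z \<in> carrier G" using z by blast
    have "h z \<in> set_power H A 2"
      using z set_power_image[OF A'_car, of 2] hA' by blast
    then obtain x a where xa: "x \<in> X" "a \<in> A" "h z = x \<otimes>\<^bsub>H\<^esub> a"
      using X(4) by (blast elim: set_multE)
    obtain a' where a': "a' \<in> A'" "a = h a'" using xa(2) hA' by blast
    have a'_car: "a' \<in> carrier G" using a' A'_car by blast
    have x_car: "x \<in> carrier H" using xa X(1) by blast
    have "h (z \<otimes> inv a') = x"
      using xa(3) a' a'_car z_car x_car by (simp add: H.m_assoc)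
    then have "z \<otimes> inv a' \<in> X'" using xa(1) z_car a'_car by (simp add: X'_def)
    then have "(z \<otimes> inv a') \<otimes> a' \<in> X' <#> A'" using a'(1) by (rule set_multI)
    then show "z \<in> X' <#> A'" using z_car a'_car by (simp add: G.m_assoc)
  qed
  moreover have "\<one> \<in> A'" using one by (simp add: A'_def)
  ultimately show ?thesis
    unfolding approximate_subgroup_def using finA' A'_car \<open>set_inv A' = A'\<close> finX' X(3)
    by (intro conjI exI[of _ X']) (auto simp: X'_def)
qed

text \<open>Homomorphisms separating h g from the identity are composed with h. Their targets live
  on the type belonging to \<open>H\<close>, hence \<open>residually_nilpotentI\<close>.\<close>

lemma residually_nilpotent_domain:
  assumes "residually_nilpotent H"
  shows "residually_nilpotent G"
proof (rule residually_nilpotentI[OF G.group_axioms])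
  fix g assume g: "g \<in> carrier G" "g \<noteq> \<one>"
  then have "h g \<noteq> \<one>\<^bsub>H\<^esub>"
    using inj_onD[OF inj, of g \<one>] by auto
  then obtain N :: "'c set monoid" and \<pi> where "nilpotent_group N" "\<pi> \<in> hom H N" "\<pi> (h g) \<noteq> \<one>\<^bsub>N\<^esub>"
    using assms hom_closed[OF g(1)] unfolding residually_nilpotent_def by blast
  then show "\<exists>(N :: 'c set monoid) \<pi>. nilpotent_group N \<and> \<pi> \<in> hom G N \<and> \<pi> g \<noteq> \<one>\<^bsub>N\<^esub>"
    using Group.hom_compose[OF homh] by (intro exI[of _ N] exI[of _ "\<pi> \<circ> h"]) auto
qed

lemma nilpotent_cover_image:
  assumes C: "subgroup C G" and N: "N \<lhd> G\<lparr>carrier := C\<rparr>"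
    and nil: "nilpotent_of_step_at_most (G\<lparr>carrier := C\<rparr> Mod N) s"
    and cover: "covered_by_left_cosets G A C r"
  shows "subgroup (h ` C) H" "h ` N \<lhd> H\<lparr>carrier := h ` C\<rparr>"
    "nilpotent_of_step_at_most (H\<lparr>carrier := h ` C\<rparr> Mod h ` N) s"
    "covered_by_left_cosets H (h ` A) (h ` C) r"
proof -
  have nN: "G.normal_in N C" using N by (simp add: G.normal_in_iff_normal[OF C])
  have C_car: "C \<subseteq> carrier G" using subgroup.subset[OF C] .
  have NC: "N \<subseteq> C" using G.normal_in_subset[OF nN] .
  show hC: "subgroup (h ` C) H" by (rule subgroup_img_is_subgroup[OF C])
  have "H.normal_in (h ` N) (h ` C)"
    unfolding H.normal_in_def
  proof (intro conjI ballI)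
    show "subgroup (h ` N) H"
      by (rule subgroup_img_is_subgroup[OF G.normal_in_subgroup[OF nN]])
    show "h ` N \<subseteq> h ` C" using NC by blast
    fix c x assume "c \<in> h ` C" "x \<in> h ` N"
    then obtain c' x' where cx: "c' \<in> C" "c = h c'" "x' \<in> N" "x = h x'" by blast
    then have "c \<otimes>\<^bsub>H\<^esub> x \<otimes>\<^bsub>H\<^esub> inv\<^bsub>H\<^esub> c = h (c' \<otimes> x' \<otimes> inv c')"
      using C_car NC by (auto simp: subset_iff)
    then show "c \<otimes>\<^bsub>H\<^esub> x \<otimes>\<^bsub>H\<^esub> inv\<^bsub>H\<^esub> c \<in> h ` N"
      using G.normal_in_conj[OF nN] cx by blast
  qed
  then show n: "h ` N \<lhd> H\<lparr>carrier := h ` C\<rparr>"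
    by (simp add: H.normal_in_iff_normal[OF hC])
  interpret C: group_hom "G\<lparr>carrier := C\<rparr>" "H\<lparr>carrier := h ` C\<rparr>" h
    using G.subgroup_imp_group[OF C] H.subgroup_imp_group[OF hC] C_car
    by (auto simp: group_hom_def group_hom_axioms_def hom_def subset_iff)
  have "lower_central (G\<lparr>carrier := C\<rparr>) s \<subseteq> N"
    using nil by (simp add: normal.nilpotent_FactGroup_iff[OF N])
  then have "lower_central (H\<lparr>carrier := h ` C\<rparr>) s \<subseteq> h ` N"
    using C.lower_central_image_surj[of s] by auto
  then show "nilpotent_of_step_at_most (H\<lparr>carrier := h ` C\<rparr> Mod h ` N) s"
    by (simp add: normal.nilpotent_FactGroup_iff[OF n])
  obtain F where F: "F \<subseteq> lcosets C" "finite F" "real (card F) \<le> r" "A \<subseteq> \<Union>F"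
    using cover unfolding covered_by_left_cosets_def by blast
  have "(`) h ` F \<subseteq> lcosets\<^bsub>H\<^esub> (h ` C)"
  proof
    fix Y assume "Y \<in> (`) h ` F"
    then obtain a where a: "a \<in> carrier G" "Y = h ` (a <# C)"
      using F(1) by (auto simp: LCOSETS_def)
    then have "Y = h a <#\<^bsub>H\<^esub> h ` C"
      using C_car by (auto simp: l_coset_def subset_iff image_UN)
    then show "Y \<in> lcosets\<^bsub>H\<^esub> (h ` C)"
      using a(1) by (auto simp: LCOSETS_def)
  qed
  moreover have "real (card ((`) h ` F)) \<le> r"
    using card_image_le[OF F(2), of "(`) h"] F(3) by linarith
  moreover have "h ` A \<subseteq> \<Union> ((`) h ` F)" using F(4) by blast
  ultimately show "covered_by_left_cosets H (h ` A) (h ` C) r"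
    unfolding covered_by_left_cosets_def using F(2) by blast
qed

end

text \<open>The union of the powers of \<open>A\<close> is a countable subgroup; its structure is
  carried to the natural numbers along an injection.\<close>

lemma (in approximate_group) countable_embedding:
  obtains G' :: "nat monoid" and h where "group_embedding G' G h" "A \<subseteq> h ` carrier G'"
proof -
  define S where "S = (\<Union>n. P n)"
  have S: "subgroup S G"
  proof (rule subgroupI)
    show "S \<subseteq> carrier G" using P_subset by (auto simp: S_def)
    show "S \<noteq> {}" using one_in_P by (auto simp: S_def)
    show "inv a \<in> S" if "a \<in> S" for a using that P_inv by (auto simp: S_def)
    show "a \<otimes> b \<in> S" if "a \<in> S" "b \<in> S" for a b using that P_mult by (fastforce simp: S_def)
  qed
  have "countable S" unfolding S_def by (rule countable_UN) (auto intro: countable_finite finite_P)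
  then obtain f :: "'a \<Rightarrow> nat" where f: "inj_on f S" by (rule countableE)
  let ?S = "G\<lparr>carrier := S\<rparr>"
  interpret S: group ?S by (rule subgroup_imp_group[OF S])
  have f': "inj_on f (carrier ?S)" using f by simp
  define G' where "G' = image_group f ?S"
  define h where "h = inv_into S f"
  have iso: "h \<in> iso G' ?S"
    using S.iso_set_sym[OF inj_imp_image_group_iso[OF f']] by (simp add: G'_def h_def)
  have "group G'" unfolding G'_def by (rule S.inj_imp_image_group_is_group[OF f'])
  moreover have "h \<in> hom G' G"
    using iso subgroup.subset[OF S] by (auto simp: iso_def hom_def)
  moreover have "inj_on h (carrier G')" and img: "h ` carrier G' = S"
    using iso by (auto simp: iso_def bij_betw_def)
  ultimately have "group_embedding G' G h"
    by (simp add: group_embedding_def group_embedding_axioms_def group_hom_def group_hom_axioms_def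
        group_axioms)
  moreover have "A \<subseteq> h ` carrier G'"
    unfolding img S_def using P_one by blast
  ultimately show thesis by (rule that)
qed

text \<open>\<open>A\<close> is pulled back with the same \<open>K\<close>, and \<open>H\<close> and
  \<open>C\<close> are pushed forward. Set powers, step and coset count survive, so the same c and m
  work.\<close>

lemma uniform_bounds_nat_imp:
  assumes nat: "uniform_bounds TYPE(nat) c m"
  shows "uniform_bounds TYPE('a) c m"
  unfolding uniform_bounds_def
proof (intro allI impI)
  fix G :: "'a monoid" and K :: real and A
  assume G: "group G" "residually_nilpotent G" and K: "1 \<le> K" "approximate_subgroup G K A"
  interpret approximate_group G A K
    using G K by (simp add: approximate_group_def approximate_group_axioms_def)
  obtain G' :: "nat monoid" and h where emb: "group_embedding G' G h" and A: "A \<subseteq> h ` carrier G'"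
    by (rule countable_embedding)
  interpret h: group_embedding G' G h by (rule emb)
  define A' where "A' = {x \<in> carrier G'. h x \<in> A}"
  have hA': "h ` A' = A" using A by (auto simp: A'_def)
  have "approximate_subgroup G' K A'"
    unfolding A'_def by (rule h.approximate_subgroup_vimage[OF K(2) A])
  then obtain H C s where C: "subgroup C G'" "H \<lhd> G'\<lparr>carrier := C\<rparr>" "H \<subseteq> set_power G' A' (m K)"
    "real s \<le> K ^ 6" "nilpotent_of_step_at_most (G'\<lparr>carrier := C\<rparr> Mod H) s"
    "covered_by_left_cosets G' A' C (exp (K powr c))"
    using nat h.G.group_axioms h.residually_nilpotent_domain[OF G(2)] K(1)
    unfolding uniform_bounds_def by blast
  have "h ` H \<subseteq> set_power G A (m K)"
    using C(3) h.set_power_image[of A' "m K"] hA' by (auto simp: A'_def)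
  then show "\<exists>H C. subgroup C G \<and> H \<lhd> G\<lparr>carrier := C\<rparr> \<and> H \<subseteq> set_power G A (m K) \<and>
      (\<exists>s::nat. real s \<le> K ^ 6 \<and> nilpotent_of_step_at_most (G\<lparr>carrier := C\<rparr> Mod H) s) \<and>
      covered_by_left_cosets G A C (exp (K powr c))"
    using h.nilpotent_cover_image[OF C(1,2,5,6)] C(4) hA' by blast
qed

theorem theorem1p2:
  shows "(\<exists>c\<^sub>0 > 0. \<exists>m. (\<forall>K\<ge>1. 1 \<le> m K) \<and> uniform_bounds TYPE('a) c\<^sub>0 m) \<and>
         (\<forall>c\<^sub>0 m. uniform_bounds TYPE(nat) c\<^sub>0 m \<longrightarrow> uniform_bounds TYPE('a) c\<^sub>0 m)"
proof (intro conjI allI impI)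
  show "\<exists>c\<^sub>0 > 0. \<exists>m. (\<forall>K\<ge>1. 1 \<le> m K) \<and> uniform_bounds TYPE('a) c\<^sub>0 m"
    using uniform_bounds_total_power_bound by (intro exI[of _ 22] conjI exI) auto
qed (rule uniform_bounds_nat_imp)

end
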